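(* Let $X\subset\mathbb{R}^2$ be the metric measure space described in the context (a doubling, in fact Ahlfors $1$-regular, metric measure space), let $(\varepsilon_j)_{j\in\mathbb{N}}$ be a sequence of numbers $\varepsilon_j\in(0,1]$ with $\varepsilon_j\to0$, and let $h(t)=t^{-1}\log^{-3}(e/t)$ for $t\in(0,1)$. Then the weight $f=f_h$ on $X$ satisfies $f\in A_\infty$ but $f\notin RH_p$ for any $p>1$. In particular, $A_\infty$ weights on a space of homogeneous type (even a metric one) need not satisfy a strong Reverse Hölder Inequality.
   Context: The space: equip $\mathbb{R}^2$ with the $\ell^\infty$ metric. Let $A=\{(u,0):u\in\mathbb{R}\}$, $U=\{(u,\tfrac12u):u\in(0,1]\}$, $V=\{(1,v):v\in[\tfrac12,1]\}$, $W=U\cup V$, and for $j\in\mathbb{N}$ let $U_j=U+(10j,0)$, $V_j=V+(10j,0)$, $W_j=W+(10j,0)=U_j\cup V_j$. Set $X=A\cup\bigcup_{j\in\mathbb{N}}W_j$ with the $\ell^\infty$ metric and the arc-length measure $\mu$. The weight: for a positive function $h$ on $(0,1)$ let $g(t)=\max\{h(t),1\}$ and define $f=f_h:X\to(0,\infty)$ by $f(x)=1$ if $x\in A$; $f(x)=\varepsilon_j$ if $x\in V_j$; $f(x)=\min\{1,\varepsilon_j g(u)\}$ if $x=(10j+u,\tfrac12u)\in U_j$ (points common to $U_j$ and $V_j$ have measure zero and are irrelevant). Weight classes: with $Mf(x)=\sup_{B\ni x}\frac{1}{\mu(B)}\int_B|f|\,d\mu$ (supremum over balls of $X$ containing $x$),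 a weight (nonnegative measurable function) $w$ belongs to $A_\infty$ if $\sup_B\frac{1}{w(B)}\int_B M(1_Bw)\,d\mu<\infty$, the supremum over all balls $B$ of $X$, where $w(B)=\int_B w\,d\mu$. For $q\in(1,\infty)$, $w\in RH_q$ if there is a finite constant $C$ with $\left(\frac{1}{\mu(B)}\int_Bw^q\,d\mu\right)^{1/q}\le C\frac{1}{\mu(B)}\int_Bw\,d\mu$ for every ball $B$. *)

theory Defs
  imports "HOL-Analysis.Analysis"
begin

section \<open>Metric measure spaces\<close>

text \<open>A metric measure space is given by a metric \<open>m\<close> (with carrier \<open>mspace m\<close>) and a measure
  \<open>M\<close> with \<open>space M = mspace m\<close>. Balls are open balls with centre in the space.\<close>

definition balls :: "'a metric \<Rightarrow> 'a set set" where
  "balls m = {mball_of m x r | x r. x \<in> mspace m \<and> r > 0}"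

definition borel_metric_measure :: "'a metric \<Rightarrow> 'a measure \<Rightarrow> bool" where
  "borel_metric_measure m M \<longleftrightarrow>
     space M = mspace m \<and> (\<forall>S. openin (mtopology_of m) S \<longrightarrow> S \<in> sets M)"

definition doubling :: "'a metric \<Rightarrow> 'a measure \<Rightarrow> bool" where
  "doubling m M \<longleftrightarrow>
     (\<forall>B \<in> balls m. 0 < emeasure M B \<and> emeasure M B < \<infinity>) \<and>
     (\<exists>C::real. \<forall>x \<in> mspace m. \<forall>r > 0.
        emeasure M (mball_of m x (2 * r)) \<le> ennreal C * emeasure M (mball_of m x r))"

text \<open>All radii are allowed: this is the notion for unbounded spaces, where the customary
  restriction \<open>r \<le> diam\<close> is void.\<close>

definition ahlfors_regular :: "real \<Rightarrow> 'a metric \<Rightarrow> 'a measure \<Rightarrow> bool" where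
  "ahlfors_regular Q m M \<longleftrightarrow>
     (\<exists>c::real. \<exists>C::real. 0 < c \<and> (\<forall>x \<in> mspace m. \<forall>r > 0.
        ennreal (c * r powr Q) \<le> emeasure M (mball_of m x r) \<and>
        emeasure M (mball_of m x r) \<le> ennreal (C * r powr Q)))"


section \<open>Weight classes\<close>

definition weight :: "'a measure \<Rightarrow> ('a \<Rightarrow> real) \<Rightarrow> bool" where
  "weight M w \<longleftrightarrow> w \<in> borel_measurable M \<and> (\<forall>x \<in> space M. 0 \<le> w x)"

definition average :: "'a measure \<Rightarrow> 'a set \<Rightarrow> ('a \<Rightarrow> real) \<Rightarrow> ennreal" where
  "average M B f = (\<integral>\<^sup>+x\<in>B. ennreal \<bar>f x\<bar> \<partial>M) / emeasure M B"

definition maximal_function :: "'a metric \<Rightarrow> 'a measure \<Rightarrow> ('a \<Rightarrow> real) \<Rightarrow> 'a \<Rightarrow> ennreal" where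
  "maximal_function m M f x = (SUP B \<in> {B \<in> balls m. x \<in> B}. average M B f)"

definition weight_mass :: "'a measure \<Rightarrow> ('a \<Rightarrow> real) \<Rightarrow> 'a set \<Rightarrow> ennreal" where
  "weight_mass M w B = (\<integral>\<^sup>+x\<in>B. ennreal (w x) \<partial>M)"

text \<open>The condition on \<open>weight_mass\<close> makes the factor \<open>1 / w(B)\<close> meaningful; without it the
  conventions \<open>0 / 0 = 0\<close> and \<open>x / \<infinity> = 0\<close> of \<^typ>\<open>ennreal\<close> would intervene.\<close>

definition A_infinity :: "'a metric \<Rightarrow> 'a measure \<Rightarrow> ('a \<Rightarrow> real) \<Rightarrow> bool" where
  "A_infinity m M w \<longleftrightarrow>
     weight M w \<and>
     (\<forall>B \<in> balls m. 0 < weight_mass M w B \<and> weight_mass M w B < \<infinity>) \<and>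
     (SUP B \<in> balls m.
        (\<integral>\<^sup>+x\<in>B. maximal_function m M (\<lambda>y. indicator B y * w y) x \<partial>M) / weight_mass M w B) < \<infinity>"

text \<open>Real powers with positive exponent on \<open>[0, \<infinity>]\<close>.\<close>

definition ennreal_powr :: "ennreal \<Rightarrow> real \<Rightarrow> ennreal" where
  "ennreal_powr x a = (if x = \<infinity> then \<infinity> else ennreal (enn2real x powr a))"

definition reverse_holder :: "real \<Rightarrow> 'a metric \<Rightarrow> 'a measure \<Rightarrow> ('a \<Rightarrow> real) \<Rightarrow> bool" where
  "reverse_holder q m M w \<longleftrightarrow>
     weight M w \<and>
     (\<exists>C::real. \<forall>B \<in> balls m.
        ennreal_powr (average M B (\<lambda>x. w x powr q)) (1 / q) \<le> ennreal C * average M B w)"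


section \<open>The space\<close>

definition seg_A :: "(real \<times> real) set" where
  "seg_A = {(u, 0) | u. True}"

definition seg_U :: "nat \<Rightarrow> (real \<times> real) set" where
  "seg_U j = (\<lambda>p. p + (10 * real j, 0)) ` {(u, 1/2 * u) | u. u \<in> {0<..1}}"

definition seg_V :: "nat \<Rightarrow> (real \<times> real) set" where
  "seg_V j = (\<lambda>p. p + (10 * real j, 0)) ` {(1, v) | v. v \<in> {1/2..1}}"

definition seg_W :: "nat \<Rightarrow> (real \<times> real) set" where
  "seg_W j = seg_U j \<union> seg_V j"

definition X_set :: "(real \<times> real) set" where
  "X_set = seg_A \<union> (\<Union>j. seg_W j)"

definition X_metric :: "(real \<times> real) metric" where
  "X_metric = metric (X_set, \<lambda>x y. infnorm (x - y))"

lemma infnorm_prod: "infnorm (p :: real \<times> real) = max \<bar>fst p\<bar> \<bar>snd p\<bar>"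
proof -
  have "(\<lambda>i. \<bar>p \<bullet> i\<bar>) ` Basis = {\<bar>fst p\<bar>, \<bar>snd p\<bar>}"
    by (cases p) (auto simp: Basis_prod_def image_Un image_image)
  then show ?thesis
    by (simp add: infnorm_Max)
qed

lemma Metric_space_infnorm: "Metric_space S (\<lambda>x y. infnorm (x - y :: 'a::euclidean_space))"
proof
  fix x y z :: 'a
  show "infnorm (x - z) \<le> infnorm (x - y) + infnorm (y - z)"
    using infnorm_triangle[of "x - y" "y - z"] by simp
qed (auto simp: infnorm_pos_le infnorm_sub infnorm_eq_0)

lemma mspace_X_metric [simp]: "mspace X_metric = X_set"
  and mdist_X_metric [simp]: "mdist X_metric = (\<lambda>x y. infnorm (x - y))"
  by (simp_all add: X_metric_def Metric_space.mspace_metric Metric_space.mdist_metric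
      Metric_space_infnorm)

text \<open>Parametrizations of the pieces of the space. They are isometries for the \<open>\<ell>\<^sup>\<infinity>\<close> metric, so
  arc length on each piece is Lebesgue measure in the parameter. The pieces overlap only in the
  common endpoints of \<open>seg_U j\<close> and \<open>seg_V j\<close>.\<close>

definition par_A :: "real \<Rightarrow> real \<times> real" where
  "par_A u = (u, 0)"

definition par_U :: "nat \<Rightarrow> real \<Rightarrow> real \<times> real" where
  "par_U j u = (10 * real j + u, 1/2 * u)"

definition par_V :: "nat \<Rightarrow> real \<Rightarrow> real \<times> real" where
  "par_V j v = (10 * real j + 1, v)"

lemma par_images: "seg_A = range par_A" "seg_U j = par_U j ` {0<..1}" "seg_V j = par_V j ` {1/2..1}"
proof -
  show "seg_A = range par_A"
    by (auto simp: seg_A_def par_A_def)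
  have "{(u, 1/2 * u) | u. u \<in> {0<..1}} = (\<lambda>u. (u, 1/2 * u)) ` {0<..1::real}"
    by (rule Setcompr_eq_image)
  then show "seg_U j = par_U j ` {0<..1}"
    unfolding seg_U_def par_U_def by (simp only: image_image) (simp add: add.commute)
  have "{(1::real, v) | v. v \<in> {1/2..1}} = Pair 1 ` {1/2..1::real}"
    by (rule Setcompr_eq_image)
  then show "seg_V j = par_V j ` {1/2..1}"
    unfolding seg_V_def par_V_def by (simp only: image_image) (simp add: add.commute)
qed

lemma par_isometric:
  "infnorm (par_A s - par_A t) = \<bar>s - t\<bar>"
  "infnorm (par_U j s - par_U j t) = \<bar>s - t\<bar>"
  "infnorm (par_V j s - par_V j t) = \<bar>s - t\<bar>"
  by (auto simp: infnorm_prod par_A_def par_U_def par_V_def abs_if max_def)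

definition arc_length :: "(real \<times> real) set \<Rightarrow> ennreal" where
  "arc_length E =
     emeasure lborel {u. par_A u \<in> E} +
     (\<Sum>j. emeasure lborel {u \<in> {0<..1}. par_U j u \<in> E} +
          emeasure lborel {v \<in> {1/2..1}. par_V j v \<in> E})"

definition X_measure :: "(real \<times> real) measure" where
  "X_measure = measure_of X_set (sets (restrict_space borel X_set)) arc_length"

lemma space_X_measure [simp]: "space X_measure = X_set"
  and sets_X_measure: "sets X_measure = sets (restrict_space borel X_set)"
  using sets.sigma_sets_eq[of "restrict_space borel X_set"]
    sets.space_closed[of "restrict_space borel X_set"]
  by (simp_all add: X_measure_def space_restrict_space)

lemma X_set_borel: "X_set \<in> sets borel"
proof -
  have A: "seg_A \<in> sets borel"
  proof -
    have "seg_A = UNIV \<times> {0}"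
      by (auto simp: seg_A_def)
    then show ?thesis
      using borel_closed[OF closed_Times[OF closed_UNIV closed_singleton]] by metis
  qed
  have V: "seg_V j \<in> sets borel" for j
  proof -
    have "seg_V j = {10 * real j + 1} \<times> {1/2..1}"
      by (auto simp: par_images par_V_def)
    then show ?thesis
      by (simp add: borel_closed closed_Times)
  qed
  have U: "seg_U j \<in> sets borel" for j
  proof -
    have eq: "seg_U j = {p. fst p = 10 * real j + 2 * snd p} \<inter> (UNIV \<times> {..1/2}) \<inter> (UNIV \<times> {0<..})"
    proof (intro equalityI subsetI)
      fix p assume "p \<in> {p. fst p = 10 * real j + 2 * snd p} \<inter> (UNIV \<times> {..1/2}) \<inter> (UNIV \<times> {0<..})"
      then have "p = par_U j (2 * snd p)" "2 * snd p \<in> {0<..1}"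
        by (auto simp: par_U_def prod_eq_iff)
      then show "p \<in> seg_U j"
        unfolding par_images by (rule image_eqI)
    qed (auto simp: par_images par_U_def)
    have 1: "{p :: real \<times> real. fst p = 10 * real j + 2 * snd p} \<in> sets borel"
      by (intro borel_closed closed_Collect_eq continuous_intros)
    have 2: "(UNIV :: real set) \<times> {..1/2::real} \<in> sets borel"
      by (intro borel_closed closed_Times) simp_all
    have 3: "(UNIV :: real set) \<times> {0::real<..} \<in> sets borel"
      by (intro borel_open open_Times) simp_all
    show ?thesis
      unfolding eq by (rule sets.Int[OF sets.Int[OF 1 2] 3])
  qed
  show ?thesis
    unfolding X_set_def seg_W_def by (intro sets.Un sets.countable_UN A) (auto intro: U V)
qed

lemma emeasure_X_measure:
  assumes E: "E \<in> sets X_measure"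
  shows "emeasure X_measure E = arc_length E"
proof -
  have borelD: "F \<in> sets borel" if "F \<in> sets (restrict_space borel X_set)" for F
    using that X_set_borel by (auto simp: sets_restrict_space)
  have cont: "continuous_on UNIV par_A" "continuous_on UNIV (par_U j)" "continuous_on UNIV (par_V j)" for j
    unfolding par_A_def par_U_def par_V_def by (intro continuous_intros)+
  have meas: "{u. par_A u \<in> F} \<in> sets borel" "{u \<in> {0<..1}. par_U j u \<in> F} \<in> sets borel"
    "{v \<in> {1/2..1}. par_V j v \<in> F} \<in> sets borel" if "F \<in> sets borel" for F j
  proof -
    have *: "par_A -` F \<in> sets borel" "par_U j -` F \<in> sets borel" "par_V j -` F \<in> sets borel"
      using cont[THEN borel_measurable_continuous_onI] that by (auto simp: measurable_def)
    have "{u. par_A u \<in> F} = par_A -` F" "{u \<in> {0<..1}. par_U j u \<in> F} = {0<..1} \<inter> par_U j -` F"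
      "{v \<in> {1/2..1}. par_V j v \<in> F} = {1/2..1} \<inter> par_V j -` F"
      by auto
    with * show "{u. par_A u \<in> F} \<in> sets borel" "{u \<in> {0<..1}. par_U j u \<in> F} \<in> sets borel"
      "{v \<in> {1/2..1}. par_V j v \<in> F} \<in> sets borel" by auto
  qed
  have "countably_additive (sets (restrict_space borel X_set)) arc_length"
  proof (rule countably_additiveI)
    fix F :: "nat \<Rightarrow> (real \<times> real) set"
    assume F: "range F \<subseteq> sets (restrict_space borel X_set)" "disjoint_family F"
    have Fb: "F n \<in> sets borel" for n
      using F borelD by auto
    have pull: "(\<Sum>n. emeasure lborel {x \<in> S. p x \<in> F n}) = emeasure lborel {x \<in> S. p x \<in> (\<Union>n. F n)}"
      if "\<And>n. {x \<in> S. p x \<in> F n} \<in> sets borel" for S :: "real set" and p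
    proof -
      have "(\<Sum>n. emeasure lborel {x \<in> S. p x \<in> F n}) = emeasure lborel (\<Union>n. {x \<in> S. p x \<in> F n})"
        using that F(2) by (intro suminf_emeasure) (auto simp: disjoint_family_on_def)
      also have "(\<Union>n. {x \<in> S. p x \<in> F n}) = {x \<in> S. p x \<in> (\<Union>n. F n)}" by auto
      finally show ?thesis .
    qed
    have pA: "(\<Sum>n. emeasure lborel {x. par_A x \<in> F n}) = emeasure lborel {x. par_A x \<in> (\<Union>n. F n)}"
      using pull[of UNIV par_A] meas(1)[OF Fb] by simp
    have swap: "(\<Sum>n. \<Sum>j. g n j) = (\<Sum>j. \<Sum>n. g n j)" for g :: "nat \<Rightarrow> nat \<Rightarrow> ennreal"
      using nn_integral_suminf[of "\<lambda>n j. g n j" "count_space UNIV"]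
      by (simp add: nn_integral_count_space_nat)
    define eU where "eU j S = emeasure lborel {u \<in> {0<..1}. par_U j u \<in> S}" for j S
    define eV where "eV j S = emeasure lborel {v \<in> {1/2..1}. par_V j v \<in> S}" for j S
    have pU: "(\<Sum>n. eU j (F n)) = eU j (\<Union>n. F n)" and pV: "(\<Sum>n. eV j (F n)) = eV j (\<Union>n. F n)" for j
      unfolding eU_def eV_def by (rule pull[OF meas(2)[OF Fb]], rule pull[OF meas(3)[OF Fb]])
    have al: "arc_length S = emeasure lborel {u. par_A u \<in> S} + (\<Sum>j. eU j S + eV j S)" for S
      by (simp add: arc_length_def eU_def eV_def)
    have "(\<Sum>n. \<Sum>j. eU j (F n) + eV j (F n)) = (\<Sum>j. \<Sum>n. eU j (F n) + eV j (F n))"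
      by (rule swap)
    also have "\<dots> = (\<Sum>j. eU j (\<Union>n. F n) + eV j (\<Union>n. F n))"
      unfolding pU[symmetric] pV[symmetric] by (intro suminf_cong suminf_add[symmetric] summableI)
    finally have "(\<Sum>n. \<Sum>j. eU j (F n) + eV j (F n)) = (\<Sum>j. eU j (\<Union>n. F n) + eV j (\<Union>n. F n))" .
    moreover have "(\<Sum>n. arc_length (F n)) = (\<Sum>n. emeasure lborel {x. par_A x \<in> F n}) +
        (\<Sum>n. \<Sum>j. eU j (F n) + eV j (F n))"
      unfolding al by (rule suminf_add[symmetric]) (rule summableI)+
    ultimately show "(\<Sum>n. arc_length (F n)) = arc_length (\<Union>n. F n)"
      unfolding al pA by (metis (no_types, lifting))
  qed
  moreover have "positive (sets (restrict_space borel X_set)) arc_length"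
    by (auto simp: positive_def arc_length_def)
  moreover have "sigma_algebra X_set (sets (restrict_space borel X_set))"
    using sets.sigma_algebra_axioms[of "restrict_space borel X_set"]
    by (simp add: space_restrict_space)
  ultimately show ?thesis
    using E unfolding sets_X_measure unfolding X_measure_def
    by (intro emeasure_measure_of_sigma)
qed


section \<open>The weight\<close>

text \<open>At the common endpoint of \<open>seg_U j\<close> and \<open>seg_V j\<close>, a null set, the value on \<open>seg_V j\<close> is
  taken, so \<open>h\<close> is only evaluated on \<open>(0, 1)\<close>. The lemmas below confirm that the index \<open>j\<close> in the
  definition is the intended one.\<close>

definition weight_f :: "(nat \<Rightarrow> real) \<Rightarrow> (real \<Rightarrow> real) \<Rightarrow> real \<times> real \<Rightarrow> real" where
  "weight_f \<epsilon> h x =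
     (let g = (\<lambda>t. max (h t) 1); j = (THE j. x \<in> seg_W j)
      in if x \<in> seg_A then 1
         else if x \<in> seg_V j then \<epsilon> j
         else min 1 (\<epsilon> j * g (fst x - 10 * real j)))"

lemma seg_W_index:
  assumes "x \<in> seg_W j"
  shows "(THE j. x \<in> seg_W j) = j"
proof (rule the_equality[where P = "\<lambda>j. x \<in> seg_W j"])
  fix k
  assume "x \<in> seg_W k"
  then have "10 * real k < fst x" "fst x \<le> 10 * real k + 1"
    by (auto simp: seg_W_def par_images par_U_def par_V_def)
  moreover from assms have "10 * real j < fst x" "fst x \<le> 10 * real j + 1"
    by (auto simp: seg_W_def par_images par_U_def par_V_def)
  ultimately show "k = j"
    by linarith
qed (fact assms)

lemma weight_f_A: "x \<in> seg_A \<Longrightarrow> weight_f \<epsilon> h x = 1"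
  by (simp add: weight_f_def)

lemma weight_f_V:
  assumes "x \<in> seg_V j"
  shows "weight_f \<epsilon> h x = \<epsilon> j"
proof -
  have W: "x \<in> seg_W j"
    using assms by (simp add: seg_W_def)
  have "x \<notin> seg_A"
    using assms by (auto simp: par_images par_A_def par_V_def)
  then show ?thesis
    using assms unfolding weight_f_def seg_W_index[OF W] Let_def by simp
qed

lemma weight_f_U:
  assumes "u \<in> {0<..<1}"
  shows "weight_f \<epsilon> h (10 * real j + u, 1/2 * u) = min 1 (\<epsilon> j * max (h u) 1)"
proof -
  have U: "(10 * real j + u, 1/2 * u) \<in> seg_W j"
    using assms by (auto simp: seg_W_def par_images par_U_def image_iff)
  have "(10 * real j + u, 1/2 * u) \<notin> seg_A \<union> seg_V j"
    using assms by (auto simp: par_images par_A_def par_V_def)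
  then show ?thesis
    unfolding weight_f_def seg_W_index[OF U] Let_def by simp
qed

end

(* On W_j the weight is comparable to eps_j (1 + h), and the factor eps_j cancels in both conditions.
   The averages of h around u are controlled by 1 / (u log^2 (e/u)), which is integrable, so the
   maximal function of h is integrable although h^p is not for p > 1. Since the metric is the
   sup metric, a ball either meets A in an interval of full length 2 r, where f = 1 >= f, or is
   contained in one W_j; in the latter case either f is almost constant on it or its mass is
   comparable to eps_j. W_j itself is a ball, and it refutes the reverse Hoelder inequality as
   eps_j -> 0, because the truncation min 1 then disappears in the limit. *)

theory Submission
  imports Defs
begin

subsection \<open>Balls of the space\<close>

text \<open>On the line, \<open>h\<close> near 0 is not an A_infinity weight: on (0, s) the mass of
  \<open>h\<close> is of order log^-2(e/s), that of its maximal function at least of order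
  log^-1(e/s), and the quotient is unbounded as s tends to 0. What saves \<open>f\<close> is that
  the singular end of U_j lies on A. A ball of small radius around that end has mass at least 2 r
  because of A, so \<open>h\<close> is never tested at small scales around its singularity. Only
  balls that reach U_j from V_j without touching A come close to the singular end; they have radius
  above 1/2 and contain a fixed proportion of V_j, so that a bound of order \<epsilon>_j for the
  whole maximal function suffices. The exponent 3 is the room needed for this: averaging costs one
  logarithm, and log^-2 is still integrable against dt/t, whereas log^-1 would not be. No constant
  in the A_infinity part depends on j.\<close>

lemma mem_ball_X:
  "y \<in> mball_of X_metric x r \<longleftrightarrow>
     x \<in> X_set \<and> y \<in> X_set \<and> \<bar>fst x - fst y\<bar> < r \<and> \<bar>snd x - snd y\<bar> < r"
  by (simp add: infnorm_prod)

declare in_mball_of [simp del]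

lemma par_A_in_X: "par_A u \<in> X_set"
  and par_U_in_W: "u \<in> {0<..1} \<Longrightarrow> par_U j u \<in> seg_W j"
  and par_V_in_W: "v \<in> {1/2..1} \<Longrightarrow> par_V j v \<in> seg_W j"
  and seg_W_subset_X: "seg_W j \<subseteq> X_set"
  by (auto simp: X_set_def seg_W_def par_images)

lemma X_cases:
  assumes "x \<in> X_set"
  obtains (A) u where "x = par_A u"
    | (U) j u where "u \<in> {0<..1}" "x = par_U j u"
    | (V) j v where "v \<in> {1/2..1}" "x = par_V j v"
  using assms unfolding X_set_def seg_W_def par_images by blast

lemma sets_X_iff: "E \<in> sets X_measure \<longleftrightarrow> E \<subseteq> X_set \<and> E \<in> sets borel"
  using X_set_borel by (auto simp: sets_X_measure sets_restrict_space_iff)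

lemma seg_borel: "seg_A \<in> sets borel" "seg_V j \<in> sets borel" "seg_U j \<in> sets borel"
proof -
  have "seg_A = {p. snd p = 0}"
    by (auto simp: seg_A_def)
  moreover have "closed {p :: real \<times> real. snd p = 0}"
    by (intro closed_Collect_eq continuous_intros)
  ultimately show "seg_A \<in> sets borel"
    by (simp add: borel_closed)
  have "seg_V j = {10 * real j + 1} \<times> {1/2..1}"
    by (auto simp: par_images par_V_def)
  then show "seg_V j \<in> sets borel"
    by (simp add: borel_closed closed_Times)
  have "seg_U j = X_set \<inter> {p. fst p = 10 * real j + 2 * snd p} \<inter> {p. 0 < snd p} \<inter> {p. snd p \<le> 1/2}"
  proof (intro equalityI subsetI)
    fix p assume "p \<in> X_set \<inter> {p. fst p = 10 * real j + 2 * snd p} \<inter> {p. 0 < snd p} \<inter> {p. snd p \<le> 1/2}"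
    then have "p = par_U j (2 * snd p)" "2 * snd p \<in> {0<..1}"
      by (auto simp: par_U_def prod_eq_iff)
    then show "p \<in> seg_U j"
      unfolding par_images by (rule image_eqI)
  qed (auto simp: par_images par_U_def X_set_def seg_W_def)
  moreover have "{p :: real \<times> real. fst p = 10 * real j + 2 * snd p} \<in> sets borel"
    "{p :: real \<times> real. snd p \<le> 1/2} \<in> sets borel"
    by (intro borel_closed closed_Collect_eq closed_Collect_le continuous_intros)+
  moreover have "{p :: real \<times> real. 0 < snd p} \<in> sets borel"
    by (intro borel_open open_Collect_less continuous_intros)
  ultimately show "seg_U j \<in> sets borel"
    using X_set_borel by auto
qed

lemma seg_sets [measurable]:
  "seg_A \<in> sets X_measure" "seg_V j \<in> sets X_measure" "seg_U j \<in> sets X_measure"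
  "seg_W j \<in> sets X_measure"
  using seg_borel by (auto simp: sets_X_iff X_set_def seg_W_def)

lemma open_infnorm_ball: "open {y :: 'a::euclidean_space. infnorm (x - y) < r}"
  by (intro open_Collect_less continuous_intros continuous_on_infnorm)

lemma ball_sets [measurable]: "mball_of X_metric x r \<in> sets X_measure"
proof -
  have "mball_of X_metric x r = (if x \<in> X_set then X_set \<inter> {y. infnorm (x - y) < r} else {})"
    by (auto simp: in_mball_of)
  then show ?thesis
    using borel_open[OF open_infnorm_ball] X_set_borel by (auto simp: sets_X_iff)
qed

lemma borel_metric_measure_X: "borel_metric_measure X_metric X_measure"
  unfolding borel_metric_measure_def
proof (intro conjI allI impI)
  fix S assume S: "openin (mtopology_of X_metric) S"
  interpret Metric_space X_set "\<lambda>x y. infnorm (x - y)"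
    by (rule Metric_space_infnorm)
  have S': "S \<subseteq> X_set" "\<forall>x\<in>S. \<exists>r>0. mball x r \<subseteq> S"
    using S by (auto simp: mtopology_of_def openin_mtopology)
  \<comment> \<open>The union of all planar balls, centred in \<open>S\<close>, whose trace on
    \<open>X_set\<close> lies in \<open>S\<close>. It is open in the plane and its trace is exactly
    \<open>S\<close>, which makes \<open>S\<close> Borel.\<close>
  define T where "T = (\<Union>p\<in>{p. fst p \<in> S \<and> mball (fst p) (snd p) \<subseteq> S}. {y. infnorm (fst p - y) < snd p})"
  have "open T"
    unfolding T_def by (intro open_UN ballI open_infnorm_ball)
  moreover have "S = X_set \<inter> T"
  proof (intro equalityI subsetI)
    fix x assume "x \<in> S"
    then obtain r where "r > 0" "mball x r \<subseteq> S"
      using S' by blast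
    then have "x \<in> T"
      unfolding T_def using \<open>x \<in> S\<close> by (intro UN_I[of "(x, r)"]) (auto simp: infnorm_0)
    then show "x \<in> X_set \<inter> T"
      using \<open>x \<in> S\<close> S' by blast
  next
    fix y assume y: "y \<in> X_set \<inter> T"
    then obtain p where p: "fst p \<in> S" "mball (fst p) (snd p) \<subseteq> S" "infnorm (fst p - y) < snd p"
      unfolding T_def by blast
    then have "y \<in> mball (fst p) (snd p)"
      using y S' unfolding in_mball by blast
    then show "y \<in> S"
      using p by blast
  qed
  ultimately show "S \<in> sets X_measure"
    using X_set_borel by (auto simp: sets_X_iff borel_open)
qed simp

subsection \<open>Ahlfors regularity\<close>

lemma emeasure_lborel_translate:
  fixes c :: real
  assumes "S \<in> sets borel"
  shows "emeasure lborel ((\<lambda>x. x - c) -` S) = emeasure lborel S"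
proof -
  have "emeasure lborel S = emeasure (distr lborel borel ((+) (- c))) S"
    by (simp add: lborel_distr_plus)
  also have "\<dots> = emeasure lborel ((\<lambda>x. x - c) -` S)"
    using assms by (subst emeasure_distr) (auto intro!: arg_cong[where f = "emeasure lborel"])
  finally show ?thesis ..
qed

text \<open>The translates 10 j + \<open>S j\<close> lie in the pairwise disjoint intervals
  [10 j, 10 j + 1] and all of them in one interval of length 2 R. This keeps the measure of a large
  ball, which meets many W_j, linear in its radius.\<close>

lemma suminf_emeasure_translates_le:
  fixes S :: "nat \<Rightarrow> real set"
  assumes S: "\<And>j. S j \<in> sets borel"
    and near: "\<And>j u. u \<in> S j \<Longrightarrow> u \<in> {0..1} \<and> \<bar>10 * real j + u - a\<bar> < R"
    and R: "0 \<le> R"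
  shows "(\<Sum>j. emeasure lborel (S j)) \<le> ennreal (2 * R)"
proof -
  define T where "T j = (\<lambda>x. x - 10 * real j) -` S j" for j
  have T: "T j \<in> sets borel" for j
    unfolding T_def by (rule measurable_sets_borel[OF _ S]) simp
  have disj: "disjoint_family T"
    unfolding disjoint_family_on_def
  proof (intro ballI impI)
    fix i j :: nat assume "i \<noteq> j"
    show "T i \<inter> T j = {}"
    proof (rule ccontr)
      assume "T i \<inter> T j \<noteq> {}"
      then obtain x where "x - 10 * real i \<in> {0..1}" "x - 10 * real j \<in> {0..1}"
        using near unfolding T_def by blast
      then have "i = j" by auto
      with \<open>i \<noteq> j\<close> show False by simp
    qed
  qed
  have "(\<Sum>j. emeasure lborel (S j)) = (\<Sum>j. emeasure lborel (T j))"
    unfolding T_def by (simp add: emeasure_lborel_translate S)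
  also have "\<dots> = emeasure lborel (\<Union>j. T j)"
    using T disj by (intro suminf_emeasure) auto
  also have "\<dots> \<le> emeasure lborel {a - R..a + R}"
  proof (intro emeasure_mono UN_least subsetI)
    fix j x assume "x \<in> T j"
    with near[of "x - 10 * real j" j] show "x \<in> {a - R..a + R}"
      by (auto simp: T_def)
  qed simp
  also have "\<dots> = ennreal (2 * R)"
    using R by (simp add: mult.commute)
  finally show ?thesis .
qed

lemma par_preimages_borel:
  assumes "E \<in> sets X_measure"
  shows "{u. par_A u \<in> E} \<in> sets borel" "{u \<in> {0<..1}. par_U j u \<in> E} \<in> sets borel"
    "{v \<in> {1/2..1}. par_V j v \<in> E} \<in> sets borel"
proof -
  have E: "E \<in> sets borel"
    using assms by (simp add: sets_X_iff)
  have "par_A \<in> borel_measurable borel" "par_U j \<in> borel_measurable borel"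
    "par_V j \<in> borel_measurable borel"
    unfolding par_A_def par_U_def par_V_def
    by (intro borel_measurable_continuous_onI continuous_intros)+
  then have "par_A -` E \<in> sets borel" "par_U j -` E \<in> sets borel" "par_V j -` E \<in> sets borel"
    by (auto intro: measurable_sets_borel[OF _ E])
  then show "{u. par_A u \<in> E} \<in> sets borel" "{u \<in> {0<..1}. par_U j u \<in> E} \<in> sets borel"
    "{v \<in> {1/2..1}. par_V j v \<in> E} \<in> sets borel"
    by (auto simp: vimage_def Collect_conj_eq)
qed

lemma suminf_ge_term_ennreal: "f j \<le> (\<Sum>i. f i)" for f :: "nat \<Rightarrow> ennreal"
  using sum_le_suminf[of f "{j}"] by simp

lemma emeasure_X_lower:
  assumes E: "E \<in> sets X_measure"
  shows "emeasure lborel {u. par_A u \<in> E} \<le> emeasure X_measure E"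
    "emeasure lborel {u \<in> {0<..1}. par_U j u \<in> E} \<le> emeasure X_measure E"
    "emeasure lborel {v \<in> {1/2..1}. par_V j v \<in> E} \<le> emeasure X_measure E"
proof -
  define t where "t = (\<lambda>j. emeasure lborel {u \<in> {0<..1}. par_U j u \<in> E}
    + emeasure lborel {v \<in> {1/2..1}. par_V j v \<in> E})"
  have *: "emeasure X_measure E = emeasure lborel {u. par_A u \<in> E} + (\<Sum>j. t j)"
    using E by (simp add: emeasure_X_measure arc_length_def t_def)
  have **: "t j \<le> emeasure X_measure E"
    unfolding * using suminf_ge_term_ennreal[of t j] by (simp add: add_increasing)
  show "emeasure lborel {u. par_A u \<in> E} \<le> emeasure X_measure E"
    unfolding * by simp
  show "emeasure lborel {u \<in> {0<..1}. par_U j u \<in> E} \<le> emeasure X_measure E"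
    by (rule order_trans[OF _ **]) (simp add: t_def)
  show "emeasure lborel {v \<in> {1/2..1}. par_V j v \<in> E} \<le> emeasure X_measure E"
    by (rule order_trans[OF _ **]) (simp add: t_def)
qed

text \<open>The constant 8 is 2 + 2 + 4. The first coordinate maps A and each U_j isometrically into
  an interval of length 2 r. It is constant on V_j, so there the sum of both coordinates is used, at
  the price of doubling the radius.\<close>

lemma emeasure_ball_le:
  assumes r: "r > 0"
  shows "emeasure X_measure (mball_of X_metric x r) \<le> ennreal (8 * r)"
proof -
  define B where "B = mball_of X_metric x r"
  have B: "B \<in> sets X_measure"
    by (simp add: B_def)
  define sU where "sU j = emeasure lborel {u \<in> {0<..1}. par_U j u \<in> B}" for j
  define sV where "sV j = emeasure lborel {v \<in> {1/2..1}. par_V j v \<in> B}" for j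
  have "emeasure X_measure B = emeasure lborel {u. par_A u \<in> B} + (\<Sum>j. sU j + sV j)"
    using B by (simp add: emeasure_X_measure arc_length_def sU_def sV_def)
  also have "(\<Sum>j. sU j + sV j) = (\<Sum>j. sU j) + (\<Sum>j. sV j)"
    by (intro suminf_add[symmetric] summableI)
  also have "(\<Sum>j. sU j) \<le> ennreal (2 * r)"
    unfolding sU_def using r
    by (intro suminf_emeasure_translates_le[where a = "fst x"] par_preimages_borel B)
      (auto simp: B_def mem_ball_X par_U_def)
  also have "(\<Sum>j. sV j) \<le> ennreal (2 * (2 * r))"
    \<comment> \<open>\<open>V\<^sub>j\<close> is rotated onto the interval \<open>10 j + 1 + [1/2, 1]\<close> of the line.\<close>
    unfolding sV_def using r
    by (intro suminf_emeasure_translates_le[where a = "fst x + snd x - 1"] par_preimages_borel B)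
      (auto simp: B_def mem_ball_X par_V_def)
  also have "emeasure lborel {u. par_A u \<in> B} \<le> emeasure lborel {fst x - r..fst x + r}"
    by (intro emeasure_mono) (auto simp: B_def mem_ball_X par_A_def)
  also have "\<dots> = ennreal (2 * r)"
    using r by simp
  finally have "emeasure X_measure B \<le> ennreal (2 * r) + (ennreal (2 * r) + ennreal (2 * (2 * r)))"
    by (simp add: add_mono)
  also have "\<dots> = ennreal (8 * r)"
    using r by (simp flip: ennreal_plus)
  finally show ?thesis
    by (simp add: B_def)
qed

lemma emeasure_ball_A:
  assumes "x \<in> X_set" "\<bar>snd x\<bar> < r"
  shows "ennreal (2 * r) \<le> emeasure X_measure (mball_of X_metric x r \<inter> seg_A)"
proof -
  let ?E = "mball_of X_metric x r \<inter> seg_A"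
  have "{u. par_A u \<in> ?E} = {fst x - r<..<fst x + r}"
    using assms par_A_in_X by (auto simp: mem_ball_X par_A_def seg_A_def)
  then show ?thesis
    using emeasure_X_lower(1)[of ?E] assms by simp
qed

lemma emeasure_ball_V:
  assumes v: "v \<in> {1/2..1}" and r: "0 < r" "r \<le> 1"
  shows "ennreal (r / 4) \<le> emeasure X_measure (mball_of X_metric (par_V j v) r \<inter> seg_V j)"
proof -
  let ?E = "mball_of X_metric (par_V j v) r \<inter> seg_V j"
  \<comment> \<open>An interval of length r / 4 ending or starting at v, on whichever side stays
    within [1/2, 1]; r \<le> 1 makes a quarter of r short enough.\<close>
  define a where "a = (if v \<ge> 3/4 then v - r / 4 else v)"
  have "ennreal (r / 4) = emeasure lborel {a..a + r / 4}"
    using r by simp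
  also have "\<dots> \<le> emeasure lborel {v' \<in> {1/2..1}. par_V j v' \<in> ?E}"
  proof (intro emeasure_mono subsetI)
    fix t assume t: "t \<in> {a..a + r / 4}"
    then have t': "t \<in> {1/2..1}" "\<bar>v - t\<bar> < r"
      using v r by (auto simp: a_def split: if_splits)
    moreover have "par_V j t \<in> X_set" "par_V j v \<in> X_set" "par_V j t \<in> seg_V j"
      using t' v par_V_in_W seg_W_subset_X by (auto simp: par_images)
    ultimately show "t \<in> {v' \<in> {1/2..1}. par_V j v' \<in> ?E}"
      using r by (auto simp: mem_ball_X par_V_def)
  qed (use par_preimages_borel(3)[of ?E] in simp)
  also have "\<dots> \<le> emeasure X_measure ?E"
    by (rule emeasure_X_lower) simp
  finally show ?thesis .
qed

text \<open>The point \<open>par_U j u\<close> has height u / 2, so r \<le> u / 2 says that the ball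
  misses A. Only the side towards A is measured, because u may be the endpoint 1. Parameters in
  [u / 2, u] are kept since the weight there is comparable to its value at u.\<close>

lemma emeasure_ball_U:
  assumes u: "u \<in> {0<..1}" and r: "0 < r" "r \<le> u / 2"
  shows "ennreal r \<le> emeasure X_measure (mball_of X_metric (par_U j u) r \<inter> par_U j ` {u / 2..u})"
    and "mball_of X_metric (par_U j u) r \<inter> par_U j ` {u / 2..u} \<in> sets X_measure"
proof -
  let ?E = "mball_of X_metric (par_U j u) r \<inter> par_U j ` {u / 2..u}"
  have "compact (par_U j ` {u / 2..u})"
    unfolding par_U_def by (intro compact_continuous_image continuous_intros) auto
  moreover have "mball_of X_metric (par_U j u) r \<in> sets borel" "mball_of X_metric (par_U j u) r \<subseteq> X_set"
    using ball_sets by (auto simp: sets_X_iff)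
  ultimately show E: "?E \<in> sets X_measure"
    using borel_compact by (auto simp: sets_X_iff)
  have "ennreal r = emeasure lborel {u - r<..u}"
    using r by simp
  also have "\<dots> \<le> emeasure lborel {t \<in> {0<..1}. par_U j t \<in> ?E}"
  proof (intro emeasure_mono subsetI)
    fix t assume t: "t \<in> {u - r<..u}"
    then have t': "t \<in> {0<..1}" "\<bar>u - t\<bar> < r" "t \<in> {u / 2..u}"
      using u r by auto
    moreover have "par_U j t \<in> X_set" "par_U j u \<in> X_set"
      using t' u par_U_in_W seg_W_subset_X by blast+
    ultimately show "t \<in> {t \<in> {0<..1}. par_U j t \<in> ?E}"
      using r by (auto simp: mem_ball_X par_U_def)
  qed (use par_preimages_borel(2)[OF E] in simp)
  also have "\<dots> \<le> emeasure X_measure ?E"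
    by (rule emeasure_X_lower) (rule E)
  finally show "ennreal r \<le> emeasure X_measure ?E" .
qed

lemma emeasure_ball_ge:
  assumes x: "x \<in> X_set" and r: "r > 0"
  shows "ennreal (r / 4) \<le> emeasure X_measure (mball_of X_metric x r)"
proof -
  let ?B = "mball_of X_metric x r"
  have meets_A: ?thesis if "\<bar>snd x\<bar> < r"
  proof -
    have "ennreal (r / 4) \<le> ennreal (2 * r)"
      using r by (intro ennreal_leI) simp
    also have "\<dots> \<le> emeasure X_measure (?B \<inter> seg_A)"
      by (rule emeasure_ball_A[OF x that])
    also have "\<dots> \<le> emeasure X_measure ?B"
      by (intro emeasure_mono) auto
    finally show ?thesis .
  qed
  show ?thesis
    using x
  proof (cases rule: X_cases)
    case (A u)
    then show ?thesis using meets_A r by (simp add: par_A_def)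
  next
    case (U j u)
    show ?thesis
    proof (cases "r \<le> u / 2")
      case True
      have "ennreal (r / 4) \<le> ennreal r"
        using r by (intro ennreal_leI) simp
      also have "\<dots> \<le> emeasure X_measure (?B \<inter> par_U j ` {u / 2..u})"
        unfolding U(2) by (rule emeasure_ball_U[OF U(1) r True])
      also have "\<dots> \<le> emeasure X_measure ?B"
        by (intro emeasure_mono) auto
      finally show ?thesis .
    next
      case False
      then show ?thesis using meets_A U by (simp add: par_U_def)
    qed
  next
    case (V j v)
    show ?thesis
    proof (cases "r \<le> 1")
      case True
      have "ennreal (r / 4) \<le> emeasure X_measure (?B \<inter> seg_V j)"
        unfolding V(2) by (rule emeasure_ball_V[OF V(1) r True])
      also have "\<dots> \<le> emeasure X_measure ?B"
        by (intro emeasure_mono) auto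
      finally show ?thesis .
    next
      case False
      then show ?thesis using meets_A V by (simp add: par_V_def)
    qed
  qed
qed

lemma ahlfors_regular_X: "ahlfors_regular 1 X_metric X_measure"
  unfolding ahlfors_regular_def
  using emeasure_ball_ge emeasure_ball_le
  by (intro exI[of _ "1/4"] exI[of _ 8]) auto

lemma emeasure_balls_X:
  assumes "B \<in> balls X_metric"
  shows "0 < emeasure X_measure B" "emeasure X_measure B < \<infinity>"
proof -
  obtain x r where B: "B = mball_of X_metric x r" "x \<in> X_set" "r > 0"
    using assms by (auto simp: balls_def)
  have "0 < ennreal (r / 4)"
    using B by simp
  also have "\<dots> \<le> emeasure X_measure B"
    unfolding B(1) by (rule emeasure_ball_ge[OF B(2,3)])
  finally show "0 < emeasure X_measure B" .
  have "emeasure X_measure B \<le> ennreal (8 * r)"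
    unfolding B(1) by (rule emeasure_ball_le[OF B(3)])
  then show "emeasure X_measure B < \<infinity>"
    using ennreal_less_top le_less_trans by force
qed

lemma doubling_X: "doubling X_metric X_measure"
  unfolding doubling_def
proof (intro conjI ballI exI allI impI)
  fix x r assume x: "x \<in> mspace X_metric" and r: "(r::real) > 0"
  have "emeasure X_measure (mball_of X_metric x (2 * r)) \<le> ennreal (64 * (r / 4))"
    using emeasure_ball_le[of "2 * r" x] r by simp
  also have "\<dots> = ennreal 64 * ennreal (r / 4)"
    using r by (intro ennreal_mult) auto
  also have "\<dots> \<le> ennreal 64 * emeasure X_measure (mball_of X_metric x r)"
    using emeasure_ball_ge[of x r] x r by (intro mult_left_mono) auto
  finally show "emeasure X_measure (mball_of X_metric x (2 * r))
    \<le> ennreal 64 * emeasure X_measure (mball_of X_metric x r)" .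
qed (use emeasure_balls_X in auto)

subsection \<open>Logarithmic kernels\<close>

text \<open>As ln (e / t) = 1 - ln t, the function h of the theorem is \<open>log_kernel 3\<close>,
  and \<open>log_kernel 2\<close> is the integrable majorant of its averages.\<close>

definition log_kernel :: "nat \<Rightarrow> real \<Rightarrow> real" where
  "log_kernel n t = 1 / (t * (1 - ln t) ^ n)"

lemma log_kernel_measurable [measurable]: "log_kernel n \<in> borel_measurable borel"
  unfolding log_kernel_def by measurable

lemma log_kernel_denom_pos: "0 < t \<Longrightarrow> t \<le> 1 \<Longrightarrow> 0 < t * (1 - ln t) ^ n" for t :: real
proof -
  assume "0 < t" "t \<le> 1"
  then have "0 < 1 - ln t"
    using ln_le_zero_iff[of t] by linarith
  with \<open>0 < t\<close> show ?thesis
    by simp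
qed

lemma log_kernel_pos: "0 < t \<Longrightarrow> t \<le> 1 \<Longrightarrow> 0 < log_kernel n t"
  using log_kernel_denom_pos[of t n] by (simp add: log_kernel_def)

lemma log_kernel_1 [simp]: "log_kernel n 1 = 1"
  by (simp add: log_kernel_def)

lemma log_kernel_Suc_le:
  assumes "0 < t" "t \<le> 1"
  shows "log_kernel (Suc n) t \<le> log_kernel n t"
proof -
  have "1 \<le> 1 - ln t"
    using assms by simp
  then have "t * (1 - ln t) ^ n \<le> t * (1 - ln t) ^ Suc n"
    using assms by (intro mult_left_mono power_increasing) auto
  moreover have "0 < t * (1 - ln t) ^ n"
    using assms by (rule log_kernel_denom_pos)
  ultimately show ?thesis
    unfolding log_kernel_def by (intro divide_left_mono) (auto intro: mult_pos_pos)
qed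

text \<open>Applied with a = ln (s / u), where exp a = s / u, this absorbs a power of a logarithm
  into one power of its argument.\<close>

lemma one_plus_power_le_exp:
  fixes a :: real
  assumes "0 \<le> a" "0 < n"
  shows "(1 + a) ^ n \<le> real n ^ n * exp a"
proof -
  have "1 + a \<le> real n * (1 + a / real n)"
    using assms by (simp add: field_simps)
  also have "\<dots> \<le> real n * exp (a / real n)"
    by (intro mult_left_mono exp_ge_add_one_self) auto
  finally have "(1 + a) ^ n \<le> (real n * exp (a / real n)) ^ n"
    using assms by (intro power_mono) auto
  also have "\<dots> = real n ^ n * exp a"
    using assms by (simp add: power_mult_distrib flip: exp_of_nat_mult)
  finally show ?thesis .
qed

text \<open>For n > 1 the kernel is not monotone: it increases on [exp (1 - n), 1]. The factor n ^ n
  pays for this.\<close>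

lemma log_kernel_almost_decreasing:
  assumes "0 < u" "u \<le> s" "s \<le> 1" "0 < n"
  shows "log_kernel n s \<le> real n ^ n * log_kernel n u"
proof -
  define a where "a = ln s - ln u"
  have a: "0 \<le> a" "exp a = s / u"
    using assms by (auto simp: a_def exp_diff)
  have s: "1 \<le> 1 - ln s" and "0 < s"
    using assms by auto
  have s0: "0 \<le> (1 - ln s) ^ n"
    by (rule zero_le_power) (use s in linarith)
  have "1 - ln u = (1 - ln s) + a"
    by (simp add: a_def)
  also have "\<dots> \<le> (1 - ln s) * (1 + a)"
    using s a mult_right_mono[of 1 "1 - ln s" a] by (simp add: algebra_simps)
  finally have "(1 - ln u) ^ n \<le> ((1 - ln s) * (1 + a)) ^ n"
    using ln_le_zero_iff[of u] assms by (intro power_mono) linarith+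
  also have "\<dots> \<le> (1 - ln s) ^ n * (real n ^ n * (s / u))"
    unfolding power_mult_distrib a(2)[symmetric] using s0 a assms
    by (intro mult_left_mono one_plus_power_le_exp) auto
  finally have "u * (1 - ln u) ^ n \<le> real n ^ n * (s * (1 - ln s) ^ n)"
    using assms by (simp add: field_simps)
  moreover have "0 < u * (1 - ln u) ^ n" "0 < s * (1 - ln s) ^ n"
    using assms by (auto intro!: log_kernel_denom_pos)
  ultimately show ?thesis
    unfolding log_kernel_def by (simp add: field_simps)
qed

text \<open>Moving right costs n ^ n by almost-monotonicity; moving left by at most a factor 2 costs
  2, because only the factor 1 / t of the kernel grows in that direction. For n = 3 this is the
  constant 54 of all later comparisons.\<close>

lemma log_kernel_half:
  assumes "0 < u" "u \<le> 1" "u / 2 \<le> s" "s \<le> 1" "0 < n"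
  shows "log_kernel n s \<le> 2 * real n ^ n * log_kernel n u"
proof (cases "u \<le> s")
  case True
  have "0 \<le> log_kernel n u"
    using assms log_kernel_pos[of u n] by simp
  then have "0 \<le> real n ^ n * log_kernel n u"
    by simp
  then show ?thesis
    using log_kernel_almost_decreasing[of u s n] True assms by linarith
next
  case False
  then have s: "0 < s" "s \<le> u"
    using assms by auto
  have "0 \<le> (1 - ln u) ^ n"
    using ln_le_zero_iff[of u] assms by (intro zero_le_power) linarith
  moreover have "(1 - ln u) ^ n \<le> (1 - ln s) ^ n"
    using ln_le_zero_iff[of u] assms s ln_mono[of s u] by (intro power_mono) linarith+
  ultimately have "u * (1 - ln u) ^ n \<le> (2 * s) * (1 - ln s) ^ n"
    using assms s by (intro mult_mono) auto
  moreover have "0 < u * (1 - ln u) ^ n" "0 < s * (1 - ln s) ^ n"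
    using assms s by (auto intro!: log_kernel_denom_pos)
  ultimately have "log_kernel n s \<le> 2 * log_kernel n u"
    unfolding log_kernel_def by (simp add: field_simps)
  also have "\<dots> \<le> 2 * real n ^ n * log_kernel n u"
  proof -
    have "1 \<le> real n ^ n"
      using assms by (intro one_le_power) auto
    then show ?thesis
      using log_kernel_pos[of u n] assms by simp
  qed
  finally show ?thesis .
qed

text \<open>The integrand may be singular at 0, so the fundamental theorem is applied on
  [s / (n + 1), s] and followed by monotone convergence. Dropping the nonnegative value of F at the
  left end avoids computing its limit at 0.\<close>

lemma nn_integral_left_open_le:
  fixes f F :: "real \<Rightarrow> real"
  assumes f: "f \<in> borel_measurable borel"
    and deriv: "\<And>t. 0 < t \<Longrightarrow> t \<le> s \<Longrightarrow> (F has_real_derivative f t) (at t)"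
    and f_nonneg: "\<And>t. 0 < t \<Longrightarrow> t \<le> s \<Longrightarrow> 0 \<le> f t"
    and F_nonneg: "\<And>t. 0 < t \<Longrightarrow> t \<le> s \<Longrightarrow> 0 \<le> F t"
    and s: "0 < s"
  shows "(\<integral>\<^sup>+t\<in>{0<..s}. ennreal (f t) \<partial>lborel) \<le> ennreal (F s)"
proof -
  define a where "a n = s / real (Suc n)" for n
  have a: "0 < a n" "a n \<le> s" for n
    using s by (auto simp: a_def field_simps)
  have "a n \<le> a m" if "m \<le> n" for m n
    unfolding a_def using that s by (intro divide_left_mono) auto
  then have inc: "incseq (\<lambda>n t. ennreal (f t) * indicator {a n..s} t)"
    by (auto simp: incseq_def le_fun_def indicator_def intro: order_trans)
  have sup: "ennreal (f t) * indicator {0<..s} t = (SUP n. ennreal (f t) * indicator {a n..s} t)" for t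
  proof (cases "t \<in> {0<..s}")
    case True
    have "a \<longlonglongrightarrow> 0"
      unfolding a_def using tendsto_mult[OF tendsto_const[of s] LIMSEQ_inverse_real_of_nat]
      by (simp add: divide_inverse)
    then obtain n where "a n < t"
      using True order_tendstoD(2)[of a 0 sequentially t] by (auto simp: eventually_sequentially)
    then show ?thesis
      using True by (intro antisym SUP_upper2[of n] SUP_least) (auto simp: indicator_def)
  next
    case False
    then have "t \<notin> {a n..s}" for n
      using a(1)[of n] by auto
    then show ?thesis
      using False by simp
  qed
  have "(\<integral>\<^sup>+t. ennreal (f t) * indicator {a n..s} t \<partial>lborel) \<le> ennreal (F s)" for n
  proof -
    have "(\<integral>\<^sup>+t. ennreal (f t) * indicator {a n..s} t \<partial>lborel) = ennreal (F s - F (a n))"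
      using a[of n] f deriv f_nonneg
      by (intro nn_integral_FTC_Icc) (auto intro: has_field_derivative_at_within)
    also have "\<dots> \<le> ennreal (F s)"
      using F_nonneg[OF a] by (intro ennreal_leI) simp
    finally show ?thesis .
  qed
  then show ?thesis
    unfolding sup using inc f
    by (subst nn_integral_monotone_convergence_SUP) (auto intro: SUP_least)
qed

text \<open>The antiderivative is 1 / (n (1 - ln t) ^ n). Writing its value at s through
  \<open>log_kernel n s\<close> shows that the average over (0, s) is a kernel again, with one
  logarithm fewer.\<close>

lemma nn_integral_log_kernel_le:
  assumes "0 < s" "s \<le> 1" "0 < n"
  shows "(\<integral>\<^sup>+t\<in>{0<..s}. ennreal (log_kernel (Suc n) t) \<partial>lborel) \<le> ennreal (s * log_kernel n s / n)"
proof -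
  have "(\<integral>\<^sup>+t\<in>{0<..s}. ennreal (log_kernel (Suc n) t) \<partial>lborel) \<le> ennreal (1 / (n * (1 - ln s) ^ n))"
  proof (rule nn_integral_left_open_le)
    fix t assume t: "0 < t" "t \<le> s"
    then have l: "1 \<le> 1 - ln t"
      using assms by simp
    obtain m where n: "n = Suc m"
      using assms by (cases n) auto
    \<comment> \<open>With y = 1 - ln t, z = y ^ m and c = n, the left side is the derivative of 1 /
      (n y ^ n) in the shape in which the rule for inverses delivers it.\<close>
    have alg: "- (c * (c * z * - (1 / t)) * inverse ((c * (y * z)) ^ Suc (Suc 0))) = 1 / (t * (y * (y * z)))"
      if "0 < y" "0 < z" "0 < c" for y z c :: real
      using that t by (simp add: field_simps)
    have y: "0 < 1 - ln t" "0 < (1 - ln t) ^ m"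
      using l zero_less_power[of "1 - ln t" m] by linarith+
    then have nz: "real n * (1 - ln t) ^ n \<noteq> 0"
      using n by simp
    have "((\<lambda>t. real n * (1 - ln t) ^ n) has_real_derivative real n * (real n * (1 - ln t) ^ m * - (1 / t))) (at t)"
    proof -
      have "((\<lambda>t. 1 - ln t) has_real_derivative - (1 / t)) (at t)"
        using t by (auto intro!: derivative_eq_intros)
      from DERIV_cmult[OF DERIV_power_Suc[OF this, of m], of "real n"] show ?thesis
        unfolding n by (simp add: mult_ac)
    qed
    from DERIV_inverse_fun[OF this nz]
    have "((\<lambda>t. inverse (real n * (1 - ln t) ^ n)) has_real_derivative 1 / (t * (1 - ln t) ^ Suc n)) (at t)"
      by (rule DERIV_cong) (use alg[OF y, of "real n"] assms in \<open>simp only: n power_Suc of_nat_0_less_iff zero_less_Suc\<close>)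
    then show "((\<lambda>t. 1 / (n * (1 - ln t) ^ n)) has_real_derivative log_kernel (Suc n) t) (at t)"
      unfolding log_kernel_def by (simp only: inverse_eq_divide)
    show "0 \<le> log_kernel (Suc n) t"
      using t assms log_kernel_pos[of t "Suc n"] by simp
    show "0 \<le> 1 / (n * (1 - ln t) ^ n)"
      using l by simp
  qed (use assms in auto)
  also have "1 / (n * (1 - ln s) ^ n) = s * log_kernel n s / n"
    using assms by (simp add: log_kernel_def)
  finally show ?thesis .
qed

text \<open>The window has half-width 2 \<rho> because a ball of radius \<rho> containing a point
  stays within 2 \<rho> of it. If 4 \<rho> \<le> u, the window lies to the right of u / 2, where the
  kernel is at most 54 times its value at u; the length 4 \<rho> gives 216. Otherwise the window
  reaches down to the singularity but lies in (0, 6 \<rho>], and integrating from 0 is what really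
  loses a logarithm.\<close>

lemma nn_integral_log_kernel_3_near:
  assumes u: "0 < u" "u \<le> 1" and \<rho>: "0 < \<rho>"
  shows "(\<integral>\<^sup>+t\<in>{0<..1} \<inter> {u - 2 * \<rho>..u + 2 * \<rho>}. ennreal (log_kernel 3 t) \<partial>lborel)
    \<le> ennreal (216 * \<rho> * log_kernel 2 u)"
    (is "?I \<le> _")
proof (cases "4 * \<rho> \<le> u")
  case True
  have "?I \<le> (\<integral>\<^sup>+t\<in>{u - 2 * \<rho>..u + 2 * \<rho>}. ennreal (54 * log_kernel 2 u) \<partial>lborel)"
  proof (rule nn_integral_mono)
    fix t :: real
    show "ennreal (log_kernel 3 t) * indicator ({0<..1} \<inter> {u - 2 * \<rho>..u + 2 * \<rho>}) t
      \<le> ennreal (54 * log_kernel 2 u) * indicator {u - 2 * \<rho>..u + 2 * \<rho>} t"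
    proof (cases "t \<in> {0<..1} \<inter> {u - 2 * \<rho>..u + 2 * \<rho>}")
      case t: True
      have "log_kernel 3 t \<le> 54 * log_kernel 3 u"
        using log_kernel_half[of u t 3] u t True by auto
      also have "\<dots> \<le> 54 * log_kernel 2 u"
        using log_kernel_Suc_le[of u 2] u by simp
      finally show ?thesis
        using t by (simp add: ennreal_leI)
    qed simp
  qed
  also have "\<dots> = ennreal (54 * log_kernel 2 u) * ennreal (4 * \<rho>)"
    using \<rho> by (subst nn_integral_cmult_indicator) auto
  also have "\<dots> = ennreal (216 * \<rho> * log_kernel 2 u)"
    using \<rho> log_kernel_pos[OF u, of 2] by (subst ennreal_mult[symmetric]) (auto simp: algebra_simps)
  finally show ?thesis .
next
  case False
  define s where "s = min 1 (6 * \<rho>)"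
  have s: "0 < s" "s \<le> 1" "u \<le> s" "s \<le> 6 * \<rho>"
    using False u \<rho> by (auto simp: s_def)
  have "?I \<le> (\<integral>\<^sup>+t\<in>{0<..s}. ennreal (log_kernel (Suc 2) t) \<partial>lborel)"
    using False by (intro nn_integral_mono) (auto simp: indicator_def s_def numeral_3_eq_3 numeral_2_eq_2)
  also have "\<dots> \<le> ennreal (s * log_kernel 2 s / 2)"
    using nn_integral_log_kernel_le[of s 2] s by simp
  also have "s * log_kernel 2 s / 2 \<le> (6 * \<rho>) * (4 * log_kernel 2 u) / 2"
    using s u log_kernel_almost_decreasing[of u s 2] log_kernel_pos[of s 2]
    by (intro divide_right_mono mult_mono) auto
  also have "\<dots> \<le> 216 * \<rho> * log_kernel 2 u"
    using \<rho> log_kernel_pos[OF u, of 2] by simp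
  finally show ?thesis
    by (simp add: ennreal_leI)
qed

text \<open>The surplus power t ^ (1 - p) dominates every power of the logarithm. What remains is 1
  / t, whose divergent integral refutes every exponent p > 1.\<close>

lemma log_kernel_powr_ge:
  assumes p: "p > 1"
  obtains c where "0 < c" "c \<le> 1" "\<And>t. 0 < t \<Longrightarrow> t \<le> 1 \<Longrightarrow> c / t \<le> log_kernel 3 t powr p"
proof
  \<comment> \<open>Chosen so that a * (3 * p) = p - 1, which turns (t powr (- a)) powr (3 * p) into
    t powr (1 - p).\<close>
  define a where "a = (p - 1) / (3 * p)"
  have a: "0 < a" "a \<le> 1"
    using p by (auto simp: a_def field_simps)
  show "0 < a powr (3 * p)" "a powr (3 * p) \<le> 1"
    using a p by (auto intro: powr_le1)
  fix t :: real assume t: "0 < t" "t \<le> 1"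
  have l: "1 \<le> 1 - ln t"
    using t by simp
  then have pos: "0 < 1 - ln t"
    by linarith
  have "a * (1 - ln t) \<le> 1 + a * (- ln t)"
    using a by (simp add: algebra_simps)
  also have "\<dots> \<le> exp (a * (- ln t))"
    by (rule exp_ge_add_one_self)
  also have "\<dots> = t powr (- a)"
    using t by (simp add: powr_def)
  finally have "(a * (1 - ln t)) powr (3 * p) \<le> (t powr (- a)) powr (3 * p)"
    using a l p by (intro powr_mono2) auto
  also have "\<dots> = t powr (1 - p)"
    using p by (simp add: powr_powr a_def)
  finally have 1: "a powr (3 * p) * (1 - ln t) powr (3 * p) \<le> t powr (1 - p)"
    using a l by (simp add: powr_mult)
  have "log_kernel 3 t = t powr (- 1) * (1 - ln t) powr (- 3)"
    using t pos powr_realpow[OF pos, of 3] by (simp add: log_kernel_def powr_minus divide_inverse)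
  then have "log_kernel 3 t powr p = t powr (- p) * (1 - ln t) powr (- (3 * p))"
    using t pos by (simp only: powr_mult powr_powr) (simp add: mult.commute)
  also have "\<dots> \<ge> a powr (3 * p) / t"
  proof -
    have "a powr (3 * p) = (a powr (3 * p) * (1 - ln t) powr (3 * p)) * (1 - ln t) powr (- (3 * p))"
      using l by (simp add: powr_minus field_simps)
    also have "\<dots> \<le> t powr (1 - p) * (1 - ln t) powr (- (3 * p))"
      using 1 by (intro mult_right_mono) auto
    also have "t powr (1 - p) = t * t powr (- p)"
      using t by (simp add: powr_diff powr_minus divide_inverse)
    finally show ?thesis
      using t by (simp add: field_simps)
  qed
  finally show "a powr (3 * p) / t \<le> log_kernel 3 t powr p" .
qed

subsection \<open>Integration over the pieces\<close>

lemma index_eqI: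
  fixes s t :: real
  assumes "\<bar>(10 * real i + s) - (10 * real j + t)\<bar> \<le> 2" "s \<in> {0..1}" "t \<in> {0..1}"
  shows "i = j"
  using assms by auto

lemma par_U_in_seg_U_iff:
  "par_U i u \<in> seg_U j \<longleftrightarrow> i = j" if "u \<in> {0<..1}"
  using that index_eqI[of i u j] by (auto simp: par_images par_U_def image_iff)

lemma measurable_borel_X: "g \<in> borel_measurable borel \<Longrightarrow> g \<in> borel_measurable X_measure"
  using measurable_restrict_space1[of g borel borel X_set] measurable_cong_sets[OF sets_X_measure refl]
  by blast

lemma emeasure_seg_U_Int:
  assumes E: "E \<in> sets X_measure"
  shows "emeasure X_measure (seg_U j \<inter> E) = emeasure lborel {u \<in> {0<..1}. par_U j u \<in> E}"
proof -
  define t where "t = (\<lambda>i. emeasure lborel {u \<in> {0<..1}. par_U i u \<in> seg_U j \<inter> E}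
    + emeasure lborel {v \<in> {1/2..1}. par_V i v \<in> seg_U j \<inter> E})"
  have t: "t i = (if i = j then emeasure lborel {u \<in> {0<..1}. par_U j u \<in> E} else 0)" for i
  proof -
    have "{u \<in> {0<..1}. par_U i u \<in> seg_U j \<inter> E} = (if i = j then {u \<in> {0<..1}. par_U j u \<in> E} else {})"
      using par_U_in_seg_U_iff by auto
    \<comment> \<open>U_j and V_j share the point with parameters u = 1 and v = 1/2, so the V-part
      of the arc length over \<open>seg_U j\<close> is null but need not be empty.\<close>
    moreover have "{v \<in> {1/2..1}. par_V i v \<in> seg_U j \<inter> E} \<subseteq> {1/2}"
      by (auto simp: par_images par_U_def par_V_def)
    then have "emeasure lborel {v \<in> {1/2..1}. par_V i v \<in> seg_U j \<inter> E} \<le> emeasure lborel {1/2::real}"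
      by (intro emeasure_mono) auto
    ultimately show ?thesis
      by (auto simp: t_def)
  qed
  have A: "{u. par_A u \<in> seg_U j \<inter> E} = {}"
    by (auto simp: par_images par_A_def par_U_def)
  have "emeasure X_measure (seg_U j \<inter> E)
      = emeasure lborel {u. par_A u \<in> seg_U j \<inter> E} + (\<Sum>i. t i)"
    unfolding t_def using E by (subst emeasure_X_measure) (auto simp only: arc_length_def intro: sets.Int seg_sets)
  then have "emeasure X_measure (seg_U j \<inter> E) = (\<Sum>i. t i)"
    unfolding A by simp
  also have "\<dots> = (\<Sum>i\<in>{j}. t i)"
    by (rule suminf_finite) (auto simp: t)
  finally show ?thesis
    by (simp add: t)
qed

text \<open>The restriction of the measure to U_j, written as a density, is the image of Lebesgue
  measure on (0, 1] under \<open>par_U j\<close>; the rest is the transformation formula.\<close>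

lemma nn_integral_seg_U:
  assumes g: "g \<in> borel_measurable X_measure"
  shows "(\<integral>\<^sup>+x\<in>seg_U j. g x \<partial>X_measure) = (\<integral>\<^sup>+u\<in>{0<..1}. g (par_U j u) \<partial>lborel)"
proof -
  let ?N = "restrict_space lborel {0<..1::real}"
  have par: "par_U j \<in> measurable ?N X_measure"
  proof (rule measurableI)
    fix u assume "u \<in> space ?N"
    then show "par_U j u \<in> space X_measure"
      using par_U_in_W seg_W_subset_X by (auto simp: space_restrict_space)
  next
    fix E assume E: "E \<in> sets X_measure"
    have "par_U j -` E \<inter> space ?N = {u \<in> {0<..1}. par_U j u \<in> E}"
      by (auto simp: space_restrict_space)
    then show "par_U j -` E \<inter> space ?N \<in> sets ?N"
      using par_preimages_borel(2)[OF E, of j] by (auto simp: sets_restrict_space_iff)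
  qed
  have "density X_measure (indicator (seg_U j)) = distr ?N X_measure (par_U j)"
  proof (rule measure_eqI)
    fix E assume "E \<in> sets (density X_measure (indicator (seg_U j)))"
    then have E: "E \<in> sets X_measure"
      by simp
    have "emeasure (density X_measure (indicator (seg_U j))) E = emeasure X_measure (seg_U j \<inter> E)"
      using E by (simp add: emeasure_density flip: indicator_inter_arith)
    also have "\<dots> = emeasure lborel {u \<in> {0<..1}. par_U j u \<in> E}"
      by (rule emeasure_seg_U_Int[OF E])
    also have "{u \<in> {0<..1}. par_U j u \<in> E} = par_U j -` E \<inter> space ?N"
      by (auto simp: space_restrict_space)
    also have "emeasure lborel (par_U j -` E \<inter> space ?N) = emeasure ?N (par_U j -` E \<inter> space ?N)"
      by (intro emeasure_restrict_space[symmetric]) (auto simp: space_restrict_space)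
    also have "\<dots> = emeasure (distr ?N X_measure (par_U j)) E"
      using emeasure_distr[OF par E] by simp
    finally show "emeasure (density X_measure (indicator (seg_U j))) E = emeasure (distr ?N X_measure (par_U j)) E" .
  qed simp
  then have "(\<integral>\<^sup>+x. g x \<partial>density X_measure (indicator (seg_U j))) = (\<integral>\<^sup>+u. g (par_U j u) \<partial>?N)"
    using nn_integral_distr[OF par, of g] g by simp
  then show ?thesis
    using g by (simp add: nn_integral_density nn_integral_restrict_space mult.commute)
qed

section \<open>W_j as a ball, and general bounds for averages and maximal functions\<close>

text \<open>The centre is the tip (10 j + 1, 1). A lies at vertical distance exactly 1 and is
  excluded by the strict inequality, while every point of U_j has u > 0 and hence horizontal
  distance 1 - u < 1. This uses that U_j is open at its lower end.\<close>

lemma seg_W_eq_ball: "seg_W j = mball_of X_metric (par_V j 1) 1"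
proof (intro equalityI subsetI)
  have c: "par_V j 1 \<in> X_set"
    using par_V_in_W[of 1 j] seg_W_subset_X by auto
  {
    fix y assume "y \<in> seg_W j"
    then show "y \<in> mball_of X_metric (par_V j 1) 1"
      using c seg_W_subset_X by (auto simp: mem_ball_X) (auto simp: seg_W_def par_images par_U_def par_V_def)
  }
  fix y assume y: "y \<in> mball_of X_metric (par_V j 1) 1"
  then have "y \<in> X_set"
    by (simp add: mem_ball_X)
  then show "y \<in> seg_W j"
  proof (cases rule: X_cases)
    case (A u)
    then show ?thesis using y by (simp add: mem_ball_X par_A_def par_V_def)
  next
    case (U i u)
    then have "i = j"
      using y by (intro index_eqI[of i u j 1]) (auto simp: mem_ball_X par_U_def par_V_def)
    then show ?thesis using U par_U_in_W by simp
  next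
    case (V i v)
    then have "i = j"
      using y by (intro index_eqI[of i 1 j 1]) (auto simp: mem_ball_X par_V_def)
    then show ?thesis using V par_V_in_W by simp
  qed
qed

lemma seg_W_in_balls: "seg_W j \<in> balls X_metric"
  unfolding balls_def seg_W_eq_ball using par_V_in_W[of 1 j] seg_W_subset_X
  by (auto intro!: exI[of _ "par_V j 1"] exI[of _ "1::real"] simp del: split_paired_Ex)

lemma emeasure_seg_W: "ennreal (1/4) \<le> emeasure X_measure (seg_W j)" "emeasure X_measure (seg_W j) \<le> ennreal 8"
  unfolding seg_W_eq_ball
  using emeasure_ball_ge[of "par_V j 1" 1] emeasure_ball_le[of 1 "par_V j 1"] par_V_in_W[of 1 j] seg_W_subset_X[of j]
  by auto

lemma balls_sets: "B \<in> balls X_metric \<Longrightarrow> B \<in> sets X_measure"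
  by (auto simp: balls_def)

lemma average_le:
  assumes B: "B \<in> balls X_metric"
    and le: "(\<integral>\<^sup>+x\<in>B. ennreal \<bar>w x\<bar> \<partial>X_measure) \<le> c * emeasure X_measure B"
  shows "average X_measure B w \<le> c"
  unfolding average_def using emeasure_balls_X(1)[OF B] le
  by (intro divide_le_posI_ennreal) (auto simp: mult.commute)

lemma maximal_function_le:
  assumes "\<And>B. B \<in> balls X_metric \<Longrightarrow> x \<in> B \<Longrightarrow>
      (\<integral>\<^sup>+y\<in>B. ennreal \<bar>w y\<bar> \<partial>X_measure) \<le> c * emeasure X_measure B"
  shows "maximal_function X_metric X_measure w x \<le> c"
  unfolding maximal_function_def using assms by (intro SUP_least average_le) auto

lemma maximal_function_le_bound:
  assumes "\<And>y. y \<in> X_set \<Longrightarrow> \<bar>w y\<bar> \<le> c"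
  shows "maximal_function X_metric X_measure w x \<le> ennreal c"
proof (rule maximal_function_le)
  fix B assume B: "B \<in> balls X_metric"
  have "(\<integral>\<^sup>+y\<in>B. ennreal \<bar>w y\<bar> \<partial>X_measure) \<le> (\<integral>\<^sup>+y\<in>B. ennreal c \<partial>X_measure)"
    using assms by (intro nn_integral_mono mult_right_mono ennreal_leI) auto
  also have "\<dots> = ennreal c * emeasure X_measure B"
    using balls_sets[OF B] by (rule nn_integral_cmult_indicator)
  finally show "(\<integral>\<^sup>+y\<in>B. ennreal \<bar>w y\<bar> \<partial>X_measure) \<le> ennreal c * emeasure X_measure B" .
qed

subsection \<open>The weight\<close>

locale log_weight =
  fixes \<epsilon> :: "nat \<Rightarrow> real" and h :: "real \<Rightarrow> real"
  assumes eps: "\<And>j. \<epsilon> j \<in> {0<..1}"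
    and h: "\<And>t. t \<in> {0<..<1} \<Longrightarrow> h t = log_kernel 3 t"
begin

abbreviation "f \<equiv> weight_f \<epsilon> h"

text \<open>The weight along U_j in the parameter u. With the kernel in place of h it also makes
  sense at u = 1, where it equals \<open>\<epsilon> j\<close>, the value on V_j.\<close>

definition profile :: "nat \<Rightarrow> real \<Rightarrow> real" where
  "profile j u = min 1 (\<epsilon> j * max (log_kernel 3 u) 1)"

lemma eps_pos: "0 < \<epsilon> j" and eps_le: "\<epsilon> j \<le> 1"
  using eps[of j] by auto

lemma profile_ge: "\<epsilon> j \<le> profile j u"
  using eps_pos[of j] eps_le[of j] by (simp add: profile_def)

lemma profile_le_1: "profile j u \<le> 1"
  by (simp add: profile_def)

lemma profile_le_kernel: "0 < u \<Longrightarrow> u \<le> 1 \<Longrightarrow> profile j u \<le> \<epsilon> j * (1 + log_kernel 3 u)"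
  using eps_pos[of j] log_kernel_pos[of u 3] unfolding profile_def
  by (intro min.coboundedI2 mult_left_mono) auto

text \<open>Maximum and minimum with 1 preserve a comparison up to a factor c \<ge> 1, so
  comparisons of the kernel pass to the weight with a constant independent of
  \<open>\<epsilon> j\<close>.\<close>

lemma profile_mono_factor:
  assumes "log_kernel 3 t \<le> c * log_kernel 3 u" "1 \<le> c"
  shows "profile j t \<le> c * profile j u"
proof -
  have "c * log_kernel 3 u \<le> c * max (log_kernel 3 u) 1" "c * 1 \<le> c * max (log_kernel 3 u) 1"
    using assms by (intro mult_left_mono; simp)+
  then have "\<epsilon> j * max (log_kernel 3 t) 1 \<le> \<epsilon> j * (c * max (log_kernel 3 u) 1)"
    using assms eps_pos[of j] by (intro mult_left_mono max.boundedI) linarith+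
  then have "profile j t \<le> min 1 (c * (\<epsilon> j * max (log_kernel 3 u) 1))"
    unfolding profile_def by (intro min.mono) (simp_all add: mult_ac)
  also have "\<dots> \<le> c * profile j u"
  proof (cases "1 \<le> \<epsilon> j * max (log_kernel 3 u) 1")
    case True
    then show ?thesis
      using assms by (simp add: profile_def min.coboundedI1)
  next
    case False
    then show ?thesis
      by (simp add: profile_def)
  qed
  finally show ?thesis .
qed

lemma f_par_A: "f (par_A u) = 1"
  by (rule weight_f_A) (simp add: par_images)

lemma f_par_V: "v \<in> {1/2..1} \<Longrightarrow> f (par_V j v) = \<epsilon> j"
  by (rule weight_f_V) (simp add: par_images)

lemma f_par_U:
  assumes "u \<in> {0<..1}"
  shows "f (par_U j u) = profile j u"
proof (cases "u = 1")
  case True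
  then have "par_U j u = par_V j (1/2)"
    by (simp add: par_U_def par_V_def)
  then show ?thesis
    using True f_par_V[of "1/2" j] eps_le[of j] by (simp add: profile_def)
next
  case False
  then show ?thesis
    using assms weight_f_U[of u \<epsilon> h j] h[of u] by (simp add: par_U_def profile_def)
qed

lemma f_bounds:
  assumes "x \<in> X_set"
  shows "0 < f x" "f x \<le> 1"
proof -
  have "0 < f x \<and> f x \<le> 1"
    using assms
  proof (cases rule: X_cases)
    case (A u)
    then show ?thesis by (simp add: f_par_A)
  next
    case (U j u)
    then show ?thesis
      using f_par_U[of u j] profile_le_1[of j u] less_le_trans[OF eps_pos profile_ge] by simp
  next
    case (V j v)
    then show ?thesis using f_par_V[of v j] eps_pos eps_le by simp
  qed
  then show "0 < f x" "f x \<le> 1"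
    by auto
qed

lemma f_ge_W:
  assumes "x \<in> seg_W j"
  shows "\<epsilon> j \<le> f x"
  using assms f_par_U f_par_V profile_ge by (auto simp: seg_W_def par_images)

text \<open>The truncation at 1 is dropped, which is harmless for upper bounds and leaves a bound
  linear in \<open>\<epsilon> j\<close>.\<close>

lemma f_le_W:
  assumes "x \<in> seg_W j"
  shows "f x \<le> \<epsilon> j * (1 + indicator (seg_U j) x * log_kernel 3 (fst x - 10 * real j))"
proof (cases "x \<in> seg_U j")
  case True
  then obtain u where "u \<in> {0<..1}" "x = par_U j u"
    by (auto simp: par_images)
  then show ?thesis
    using True f_par_U profile_le_kernel[of u j] by (simp add: par_U_def)
next
  case False
  then show ?thesis
    using assms f_par_V by (auto simp: seg_W_def par_images)
qed

text \<open>The definition of the weight contains a definite description of the index. Measurability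
  is therefore glued from the countably many pieces, on each of which \<open>f\<close> agrees with a
  Borel function of the plane.\<close>

lemma f_measurable [measurable]: "f \<in> borel_measurable X_measure"
proof (rule measurable_piecewise_restrict)
  show "countable (insert seg_A (range seg_U \<union> range seg_V))"
    by simp
  show "\<Omega> \<inter> space X_measure \<in> sets X_measure"
    if "\<Omega> \<in> insert seg_A (range seg_U \<union> range seg_V)" for \<Omega>
    using that sets.top[of X_measure] by (auto intro!: sets.Int)
  show "space X_measure \<subseteq> \<Union> (insert seg_A (range seg_U \<union> range seg_V))"
    by (auto simp: X_set_def seg_W_def)
  fix \<Omega> assume \<Omega>: "\<Omega> \<in> insert seg_A (range seg_U \<union> range seg_V)"
  have ex: "\<exists>g \<in> borel_measurable borel. \<forall>x \<in> \<Omega>. f x = g x"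
    using \<Omega>
  proof (elim insertE UnE imageE)
    assume "\<Omega> = seg_A"
    then show ?thesis
      using f_par_A by (intro bexI[of _ "\<lambda>_. 1"]) (auto simp: par_images)
  next
    fix j assume "\<Omega> = seg_V j"
    then show ?thesis
      using f_par_V by (intro bexI[of _ "\<lambda>_. \<epsilon> j"]) (auto simp: par_images)
  next
    fix j assume "\<Omega> = seg_U j"
    moreover have "(\<lambda>x :: real \<times> real. profile j (fst x - 10 * real j)) \<in> borel_measurable borel"
      unfolding profile_def by (simp add: borel_prod[symmetric])
    ultimately show ?thesis
      using f_par_U
      by (intro bexI[of _ "\<lambda>x. profile j (fst x - 10 * real j)"]) (auto simp: par_images par_U_def)
  qed
  then obtain g where g: "g \<in> borel_measurable borel" "\<And>x. x \<in> \<Omega> \<Longrightarrow> f x = g x"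
    by blast
  have "g \<in> borel_measurable (restrict_space X_measure \<Omega>)"
    by (intro measurable_restrict_space1 measurable_borel_X g)
  then show "f \<in> borel_measurable (restrict_space X_measure \<Omega>)"
    by (subst measurable_cong[where g = g]) (auto simp: space_restrict_space g)
qed

lemma weight_f: "weight X_measure f"
  using f_bounds(1) by (auto simp: weight_def intro: less_imp_le)

lemma weight_mass_ge:
  assumes E: "E \<in> sets X_measure" "E \<subseteq> B" and a: "\<And>x. x \<in> E \<Longrightarrow> a \<le> f x"
  shows "ennreal a * emeasure X_measure E \<le> weight_mass X_measure f B"
proof -
  have "ennreal a * emeasure X_measure E = (\<integral>\<^sup>+x\<in>E. ennreal a \<partial>X_measure)"
    using E by (simp add: nn_integral_cmult_indicator)
  also have "\<dots> \<le> weight_mass X_measure f B"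
    unfolding weight_mass_def using E a
    by (intro nn_integral_mono) (auto simp: indicator_def intro: ennreal_leI)
  finally show ?thesis .
qed

lemma weight_mass_finite:
  assumes B: "B \<in> balls X_metric"
  shows "weight_mass X_measure f B < \<infinity>"
proof -
  have "weight_mass X_measure f B \<le> (\<integral>\<^sup>+x\<in>B. 1 \<partial>X_measure)"
    unfolding weight_mass_def using f_bounds(2) by (intro nn_integral_mono mult_right_mono) auto
  also have "\<dots> = emeasure X_measure B"
    using balls_sets[OF B] by simp
  also have "\<dots> < \<infinity>"
    by (rule emeasure_balls_X(2)[OF B])
  finally show ?thesis .
qed

lemma weight_mass_pos:
  assumes B: "B \<in> balls X_metric"
  shows "0 < weight_mass X_measure f B"
proof (rule ccontr)
  assume "\<not> ?thesis"
  then have "(\<integral>\<^sup>+x\<in>B. ennreal (f x) \<partial>X_measure) = 0"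
    by (simp add: weight_mass_def)
  moreover have sub: "B \<subseteq> X_set"
    using sets.sets_into_space[OF balls_sets[OF B]] by simp
  then have "ennreal (f x) \<noteq> 0" if "x \<in> B" for x
    using that f_bounds(1)[of x] by (auto simp: ennreal_eq_0_iff)
  then have "{x \<in> space X_measure. ennreal (f x) * indicator B x \<noteq> 0} = B"
    using sub by (auto simp: indicator_def)
  ultimately have "emeasure X_measure B = 0"
    using balls_sets[OF B] by (simp add: nn_integral_0_iff)
  then show False
    using emeasure_balls_X(1)[OF B] by simp
qed

section \<open>The A_infinity condition\<close>

text \<open>The maximal function is at most b and the ball has measure at most 8 r, while the mass
  is at least a m. The lower bound on \<open>f\<close> is asked only on a part \<open>E\<close>: in
  a ball meeting A the weight may be tiny elsewhere.\<close>

lemma maximal_mass_le_of_pinching: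
  assumes B: "B = mball_of X_metric x r" and r: "0 < r"
    and E: "E \<in> sets X_measure" "E \<subseteq> B" "ennreal m \<le> emeasure X_measure E"
    and f: "\<And>y. y \<in> E \<Longrightarrow> a \<le> f y" "\<And>y. y \<in> B \<Longrightarrow> f y \<le> b"
    and nonneg: "0 \<le> a" "0 \<le> b" "0 \<le> m" "0 \<le> K" and K: "b * (8 * r) \<le> K * (a * m)"
  shows "(\<integral>\<^sup>+y\<in>B. maximal_function X_metric X_measure (\<lambda>y. indicator B y * f y) y \<partial>X_measure)
    \<le> ennreal K * weight_mass X_measure f B"
proof -
  have "\<bar>indicator B y * f y\<bar> \<le> b" if "y \<in> X_set" for y
    using f(2)[of y] nonneg f_bounds(1)[OF that] by (auto simp: indicator_def)
  then have "(\<integral>\<^sup>+y\<in>B. maximal_function X_metric X_measure (\<lambda>y. indicator B y * f y) y \<partial>X_measure)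
      \<le> (\<integral>\<^sup>+y\<in>B. ennreal b \<partial>X_measure)"
    by (intro nn_integral_mono mult_right_mono maximal_function_le_bound) auto
  also have "\<dots> = ennreal b * emeasure X_measure B"
    by (rule nn_integral_cmult_indicator) (simp add: B)
  also have "\<dots> \<le> ennreal b * ennreal (8 * r)"
    unfolding B by (intro mult_left_mono emeasure_ball_le r) simp
  also have "\<dots> \<le> ennreal K * (ennreal a * ennreal m)"
    using K nonneg r by (simp add: ennreal_leI flip: ennreal_mult)
  also have "\<dots> \<le> ennreal K * weight_mass X_measure f B"
  proof (intro mult_left_mono)
    have "ennreal a * ennreal m \<le> ennreal a * emeasure X_measure E"
      using E by (intro mult_left_mono) auto
    also have "\<dots> \<le> weight_mass X_measure f B"
      using E f(1) by (intro weight_mass_ge) auto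
    finally show "ennreal a * ennreal m \<le> weight_mass X_measure f B" .
  qed simp
  finally show ?thesis .
qed

text \<open>Integrals of the weight over W_j carry one factor \<open>\<epsilon> j\<close>, and the
  kernel contributes along U_j only. The indicator of \<open>seg_W j\<close> allows \<open>E\<close>
  to be a ball leaving W_j, as occurs in the maximal function.\<close>

lemma nn_integral_W_le:
  assumes E: "E \<in> sets X_measure"
  shows "(\<integral>\<^sup>+y\<in>E. ennreal (indicator (seg_W j) y * f y) \<partial>X_measure)
    \<le> ennreal (\<epsilon> j) * (emeasure X_measure E
        + (\<integral>\<^sup>+u\<in>{u \<in> {0<..1}. par_U j u \<in> E}. ennreal (log_kernel 3 u) \<partial>lborel))"
proof -
  let ?k = "\<lambda>y :: real \<times> real. ennreal (log_kernel 3 (fst y - 10 * real j))"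
  have k: "?k \<in> borel_measurable X_measure"
    by (intro measurable_borel_X) (simp add: borel_prod[symmetric])
  note [measurable] = k E
  have "(\<integral>\<^sup>+y\<in>E. ennreal (indicator (seg_W j) y * f y) \<partial>X_measure)
      \<le> (\<integral>\<^sup>+y. ennreal (\<epsilon> j) * (indicator E y + ?k y * indicator E y * indicator (seg_U j) y) \<partial>X_measure)"
  proof (rule nn_integral_mono)
    fix y
    show "ennreal (indicator (seg_W j) y * f y) * indicator E y
      \<le> ennreal (\<epsilon> j) * (indicator E y + ?k y * indicator E y * indicator (seg_U j) y)"
    proof (cases "y \<in> E \<and> y \<in> seg_W j")
      case y: True
      have k0: "0 \<le> log_kernel 3 (fst y - 10 * real j)" if "y \<in> seg_U j"
        using that log_kernel_pos[of _ 3] by (force simp: par_images par_U_def intro: less_imp_le)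
      have "ennreal (f y) \<le> ennreal (\<epsilon> j * (1 + indicator (seg_U j) y * log_kernel 3 (fst y - 10 * real j)))"
        using y by (intro ennreal_leI f_le_W) auto
      also have "\<dots> = ennreal (\<epsilon> j) * (1 + ?k y * indicator (seg_U j) y)"
        using eps_pos[of j] k0 by (auto simp: indicator_def ennreal_mult ennreal_plus)
      finally show ?thesis
        using y by simp
    qed (auto simp: indicator_def)
  qed
  also have "\<dots> = ennreal (\<epsilon> j) * (emeasure X_measure E
      + (\<integral>\<^sup>+y\<in>seg_U j. ?k y * indicator E y \<partial>X_measure))"
    by (simp add: nn_integral_cmult nn_integral_add)
  also have "(\<integral>\<^sup>+y\<in>seg_U j. ?k y * indicator E y \<partial>X_measure)
      = (\<integral>\<^sup>+u\<in>{0<..1}. ?k (par_U j u) * indicator E (par_U j u) \<partial>lborel)"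
    by (rule nn_integral_seg_U) measurable
  also have "\<dots> = (\<integral>\<^sup>+u\<in>{u \<in> {0<..1}. par_U j u \<in> E}. ennreal (log_kernel 3 u) \<partial>lborel)"
    by (intro nn_integral_cong) (auto simp: indicator_def par_U_def)
  finally show ?thesis .
qed

text \<open>The first coordinate does not increase distances and sends V_j to u = 1, so one
  parameter u serves both pieces. By the window estimate and the lower bound \<rho> / 4 for the
  measure of the ball, the kernel contributes 4 * 216 = 864; the constant part of the weight
  contributes 4, since 1 \<le> 4 k.\<close>

lemma maximal_function_W_le:
  assumes B: "B \<subseteq> seg_W j" and x: "x \<in> B"
  shows "maximal_function X_metric X_measure (\<lambda>y. indicator B y * f y) x
    \<le> ennreal (868 * \<epsilon> j * log_kernel 2 (fst x - 10 * real j))"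
proof (rule maximal_function_le)
  fix B' assume B': "B' \<in> balls X_metric" and xB': "x \<in> B'"
  obtain z \<rho> where z: "B' = mball_of X_metric z \<rho>" "z \<in> X_set" and \<rho>: "0 < \<rho>"
    using B' by (auto simp: balls_def)
  define u where "u = fst x - 10 * real j"
  have u: "0 < u" "u \<le> 1"
    using B x by (auto simp: u_def seg_W_def par_images par_U_def par_V_def)
  define k where "k = log_kernel 2 u"
  have k: "1 \<le> 4 * k"
    using log_kernel_almost_decreasing[of u 1 2] u by (simp add: k_def)
  let ?\<mu> = "emeasure X_measure B'"
  have "(\<integral>\<^sup>+t\<in>{t \<in> {0<..1}. par_U j t \<in> B'}. ennreal (log_kernel 3 t) \<partial>lborel)
      \<le> (\<integral>\<^sup>+t\<in>{0<..1} \<inter> {u - 2 * \<rho>..u + 2 * \<rho>}. ennreal (log_kernel 3 t) \<partial>lborel)"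
    using xB' by (intro nn_integral_mono) (auto simp: indicator_def z mem_ball_X par_U_def u_def)
  also have "\<dots> \<le> ennreal (216 * \<rho> * k)"
    unfolding k_def by (rule nn_integral_log_kernel_3_near[OF u \<rho>])
  also have "\<dots> = ennreal (864 * k) * ennreal (\<rho> / 4)"
    using k \<rho> by (simp flip: ennreal_mult)
  also have "\<dots> \<le> ennreal (864 * k) * ?\<mu>"
    unfolding z by (intro mult_left_mono emeasure_ball_ge z \<rho>) simp
  finally have near: "(\<integral>\<^sup>+t\<in>{t \<in> {0<..1}. par_U j t \<in> B'}. ennreal (log_kernel 3 t) \<partial>lborel)
    \<le> ennreal (864 * k) * ?\<mu>" .
  have const: "?\<mu> \<le> ennreal (4 * k) * ?\<mu>"
    using mult_right_mono[of 1 "ennreal (4 * k)" ?\<mu>] k by simp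
  have "(\<integral>\<^sup>+y\<in>B'. ennreal \<bar>indicator B y * f y\<bar> \<partial>X_measure)
      \<le> (\<integral>\<^sup>+y\<in>B'. ennreal (indicator (seg_W j) y * f y) \<partial>X_measure)"
    using B f_bounds(1) by (intro nn_integral_mono mult_right_mono ennreal_leI) (auto simp: indicator_def intro: less_imp_le)
  also have "\<dots> \<le> ennreal (\<epsilon> j) * (?\<mu>
      + (\<integral>\<^sup>+t\<in>{t \<in> {0<..1}. par_U j t \<in> B'}. ennreal (log_kernel 3 t) \<partial>lborel))"
    by (rule nn_integral_W_le) (simp add: z)
  also have "\<dots> \<le> ennreal (\<epsilon> j) * (ennreal (4 * k) * ?\<mu> + ennreal (864 * k) * ?\<mu>)"
    by (intro mult_left_mono add_mono const near) simp
  also have "\<dots> = ennreal (868 * \<epsilon> j * k) * ?\<mu>"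
  proof -
    have "ennreal (4 * k) + ennreal (864 * k) = ennreal (868 * k)"
      using k by (simp flip: ennreal_plus)
    moreover have "ennreal (\<epsilon> j) * ennreal (868 * k) = ennreal (868 * \<epsilon> j * k)"
      using k eps_pos[of j] by (simp add: mult_ac flip: ennreal_mult)
    ultimately show ?thesis
      by (simp only: flip: distrib_right mult.assoc)
  qed
  finally show "(\<integral>\<^sup>+y\<in>B'. ennreal \<bar>indicator B y * f y\<bar> \<partial>X_measure)
      \<le> ennreal (868 * \<epsilon> j * log_kernel 2 (fst x - 10 * real j)) * ?\<mu>"
    by (simp add: k_def u_def)
qed

text \<open>The kernel \<open>log_kernel 2\<close> has integral at most 1 over (0, 1] and equals 1
  on V_j, and W_j has measure at most 8: 868 * (1 + 8) = 7812.\<close>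

lemma maximal_mass_W_le:
  assumes B: "B \<subseteq> seg_W j"
  shows "(\<integral>\<^sup>+x\<in>B. maximal_function X_metric X_measure (\<lambda>y. indicator B y * f y) x \<partial>X_measure)
    \<le> ennreal (7812 * \<epsilon> j)"
proof -
  let ?k = "\<lambda>y :: real \<times> real. ennreal (log_kernel 2 (fst y - 10 * real j))"
  let ?c = "ennreal (868 * \<epsilon> j)"
  have k[measurable]: "?k \<in> borel_measurable X_measure"
    by (intro measurable_borel_X) (simp add: borel_prod[symmetric])
  have "(\<integral>\<^sup>+x\<in>B. maximal_function X_metric X_measure (\<lambda>y. indicator B y * f y) x \<partial>X_measure)
      \<le> (\<integral>\<^sup>+x. ?c * (?k x * indicator (seg_U j) x + indicator (seg_W j) x) \<partial>X_measure)"
  proof (rule nn_integral_mono)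
    fix x
    show "maximal_function X_metric X_measure (\<lambda>y. indicator B y * f y) x * indicator B x
      \<le> ?c * (?k x * indicator (seg_U j) x + indicator (seg_W j) x)"
    proof (cases "x \<in> B")
      case True
      have "maximal_function X_metric X_measure (\<lambda>y. indicator B y * f y) x
          \<le> ennreal (868 * \<epsilon> j * log_kernel 2 (fst x - 10 * real j))"
        by (rule maximal_function_W_le[OF B True])
      also have "\<dots> = ?c * ?k x"
        using eps_pos[of j] by (intro ennreal_mult') simp
      also have "\<dots> \<le> ?c * (?k x * indicator (seg_U j) x + indicator (seg_W j) x)"
        using True B by (intro mult_left_mono) (auto simp: seg_W_def par_images par_V_def indicator_def)
      finally show ?thesis
        using True by simp
    qed simp
  qed
  also have "\<dots> = ?c * ((\<integral>\<^sup>+x\<in>seg_U j. ?k x \<partial>X_measure) + emeasure X_measure (seg_W j))"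
    by (simp add: nn_integral_cmult nn_integral_add)
  also have "(\<integral>\<^sup>+x\<in>seg_U j. ?k x \<partial>X_measure) = (\<integral>\<^sup>+u\<in>{0<..1}. ?k (par_U j u) \<partial>lborel)"
    by (rule nn_integral_seg_U[OF k])
  also have "\<dots> = (\<integral>\<^sup>+u\<in>{0<..1}. ennreal (log_kernel (Suc 1) u) \<partial>lborel)"
    by (simp add: par_U_def numeral_2_eq_2)
  also have "\<dots> \<le> ennreal 1"
    using nn_integral_log_kernel_le[of 1 1] by simp
  also have "emeasure X_measure (seg_W j) \<le> ennreal 8"
    by (rule emeasure_seg_W)
  finally have "(\<integral>\<^sup>+x\<in>B. maximal_function X_metric X_measure (\<lambda>y. indicator B y * f y) x \<partial>X_measure)
      \<le> ?c * (ennreal 1 + ennreal 8)"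
    by (simp add: add_mono mult_left_mono)
  also have "\<dots> = ennreal (868 * \<epsilon> j) * ennreal 9"
    by simp
  also have "\<dots> = ennreal (7812 * \<epsilon> j)"
    using eps_pos[of j] by (subst ennreal_mult[symmetric]) auto
  finally show ?thesis .
qed

text \<open>The constant comes from the one case that pinching does not cover: a ball around a point
  of V_j with 1/2 < r that misses A. Its mass is at least \<epsilon>_j / 8, and 62496 = 8 * 7812.
  The pinched cases need at most 8 * 54 * 54 = 23328.\<close>

lemma maximal_mass_le:
  assumes "B \<in> balls X_metric"
  shows "(\<integral>\<^sup>+y\<in>B. maximal_function X_metric X_measure (\<lambda>y. indicator B y * f y) y \<partial>X_measure)
    \<le> ennreal 62496 * weight_mass X_measure f B"
    (is "?I \<le> ?R")
proof -
  obtain x r where B: "B = mball_of X_metric x r" and x: "x \<in> X_set" and r: "0 < r"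
    using assms by (auto simp: balls_def)
  have B_sub: "B \<subseteq> X_set"
    by (auto simp: B mem_ball_X)
  have meets_A: ?thesis if "\<bar>snd x\<bar> < r"
  proof (rule maximal_mass_le_of_pinching[OF B r, where E = "B \<inter> seg_A" and m = "2 * r" and a = 1 and b = 1])
    show "ennreal (2 * r) \<le> emeasure X_measure (B \<inter> seg_A)"
      unfolding B by (rule emeasure_ball_A[OF x that])
    show "1 \<le> f y" if "y \<in> B \<inter> seg_A" for y
      using that f_par_A by (auto simp: par_images)
    show "f y \<le> 1" if "y \<in> B" for y
      using that B_sub f_bounds(2)[of y] by auto
  qed (use r in \<open>auto simp: B\<close>)
  show ?thesis
    using x
  proof (cases rule: X_cases)
    case (A u)
    then show ?thesis
      using meets_A r by (simp add: par_A_def)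
  next
    case (U j u)
    show ?thesis
    proof (cases "r \<le> u / 2")
      case False
      then show ?thesis
        using meets_A U by (simp add: par_U_def)
    next
      case True
      let ?E = "B \<inter> par_U j ` {u / 2..u}"
      let ?p = "profile j u"
      have p: "0 < ?p"
        using eps_pos[of j] profile_ge[of j u] by linarith
      show ?thesis
      \<comment> \<open>The ball misses A and stays at parameters above u / 2, so
        \<open>log_kernel_half\<close> compares the weight with its value at u from both sides, each
        time with the factor 54.\<close>
      proof (rule maximal_mass_le_of_pinching[OF B r, where E = ?E and m = r and a = "?p / 54" and b = "54 * ?p"])
        show "?E \<in> sets X_measure" "ennreal r \<le> emeasure X_measure ?E"
          unfolding B U(2) using emeasure_ball_U[OF U(1) r True] by auto
        show "?p / 54 \<le> f y" if "y \<in> ?E" for y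
        proof -
          from that obtain t where t: "t \<in> {u / 2..u}" "y = par_U j t"
            by blast
          have "profile j u \<le> 54 * profile j t"
            using log_kernel_half[of t u 3] t U(1) by (intro profile_mono_factor) auto
          then show ?thesis
            using f_par_U[of t j] t U(1) by auto
        qed
        show "f y \<le> 54 * ?p" if "y \<in> B" for y
        proof -
          have y: "\<bar>fst x - fst y\<bar> < r" "\<bar>snd x - snd y\<bar> < r" "y \<in> X_set"
            using that by (auto simp: B mem_ball_X)
          from y(3) show ?thesis
          proof (cases rule: X_cases)
            case (A s)
            then show ?thesis
              using y U True by (simp add: par_A_def par_U_def)
          next
            case U': (U i t)
            then have "i = j"
              using y U True by (intro index_eqI[of i t j u]) (auto simp: par_U_def)
            moreover have "profile j t \<le> 54 * ?p"
              using log_kernel_half[of u t 3] y U U' True \<open>i = j\<close>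
              by (intro profile_mono_factor) (auto simp: par_U_def)
            ultimately show ?thesis
              using U' f_par_U by simp
          next
            case V': (V i v)
            then have "i = j"
              using y U True by (intro index_eqI[of i 1 j u]) (auto simp: par_U_def par_V_def)
            then show ?thesis
              using V' f_par_V[of v j] profile_ge[of j u] p by simp
          qed
        qed
      qed (use r p in auto)
    qed
  next
    case (V j v)
    have E: "B \<inter> seg_V j \<in> sets X_measure"
      by (simp add: B)
    have f_V: "\<epsilon> j \<le> f y" if "y \<in> B \<inter> seg_V j" for y
      using that f_ge_W by (auto simp: seg_W_def)
    show ?thesis
    \<comment> \<open>The centre has height v, so this decides whether the ball meets A.\<close>
    proof (cases "r \<le> v")
      case False
      then show ?thesis
        using meets_A V by (simp add: par_V_def)
    next
      case True
      then have "r \<le> 1"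
        using V(1) by simp
      have m: "ennreal (r / 4) \<le> emeasure X_measure (B \<inter> seg_V j)"
        unfolding B V(2) by (rule emeasure_ball_V[OF V(1) r \<open>r \<le> 1\<close>])
      have B_W: "B \<subseteq> seg_W j"
      proof
        fix y assume "y \<in> B"
        then have y: "\<bar>fst x - fst y\<bar> < r" "\<bar>snd x - snd y\<bar> < r" "y \<in> X_set"
          by (auto simp: B mem_ball_X)
        from y(3) show "y \<in> seg_W j"
        proof (cases rule: X_cases)
          case (A s)
          then show ?thesis
            using y V True by (simp add: par_A_def par_V_def)
        next
          case U': (U i t)
          then have "i = j"
            using y V \<open>r \<le> 1\<close> by (intro index_eqI[of i t j 1]) (auto simp: par_U_def par_V_def)
          then show ?thesis
            using U' par_U_in_W by simp
        next
          case V': (V i w)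
          then have "i = j"
            using y V \<open>r \<le> 1\<close> by (intro index_eqI[of i 1 j 1]) (auto simp: par_V_def)
          then show ?thesis
            using V' par_V_in_W by simp
        qed
      qed
      show ?thesis
      \<comment> \<open>Up to radius 1/2 the ball keeps to parameters above 1/2 on U_j, where the
        weight is at most 54 times its value at u = 1. Beyond that it may approach the singular
        end.\<close>
      proof (cases "r \<le> 1 / 2")
        case True
        show ?thesis
        proof (rule maximal_mass_le_of_pinching[OF B r E, where m = "r / 4" and a = "\<epsilon> j" and b = "54 * \<epsilon> j"])
          show "f y \<le> 54 * \<epsilon> j" if "y \<in> B" for y
          proof (cases "y \<in> seg_V j")
            case True
            then show ?thesis
              using f_par_V eps_pos[of j] by (auto simp: par_images)
          next
            case False
            with that B_W obtain t where t: "t \<in> {0<..1}" "y = par_U j t"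
              by (auto simp: seg_W_def par_images)
            then have "profile j t \<le> 54 * profile j 1"
              using that \<open>r \<le> 1 / 2\<close> log_kernel_half[of 1 t 3]
              by (intro profile_mono_factor) (auto simp: B mem_ball_X V par_U_def par_V_def)
            then show ?thesis
              using t f_par_U[of t j] eps_le[of j] by (simp add: profile_def)
          qed
        qed (use r m f_V eps_pos[of j] in auto)
      next
        case False
        have "?I \<le> ennreal (7812 * \<epsilon> j)"
          by (rule maximal_mass_W_le[OF B_W])
        also have "\<dots> = ennreal (62496 * (\<epsilon> j * (1 / 8)))"
          by simp
        also have "\<dots> = ennreal 62496 * (ennreal (\<epsilon> j) * ennreal (1 / 8))"
          using eps_pos[of j] ennreal_mult'[of 62496 "\<epsilon> j * (1 / 8)"] ennreal_mult'[of "\<epsilon> j" "1 / 8"]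
          by (simp only: less_imp_le zero_le_numeral)
        also have "\<dots> \<le> ennreal 62496 * (ennreal (\<epsilon> j) * ennreal (r / 4))"
          using False by (intro mult_left_mono ennreal_leI) auto
        also have "\<dots> \<le> ennreal 62496 * (ennreal (\<epsilon> j) * emeasure X_measure (B \<inter> seg_V j))"
          using m by (intro mult_left_mono) auto
        also have "\<dots> \<le> ?R"
          using f_V E by (intro mult_left_mono weight_mass_ge) auto
        finally show ?thesis .
      qed
    qed
  qed
qed

lemma A_infinity_f: "A_infinity X_metric X_measure f"
  unfolding A_infinity_def
proof (intro conjI ballI weight_f weight_mass_pos weight_mass_finite)
  have "(SUP B \<in> balls X_metric.
        (\<integral>\<^sup>+x\<in>B. maximal_function X_metric X_measure (\<lambda>y. indicator B y * f y) x \<partial>X_measure)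
          / weight_mass X_measure f B) \<le> ennreal 62496"
    using weight_mass_pos maximal_mass_le
    by (intro SUP_least divide_le_posI_ennreal) (simp_all add: mult.commute)
  also have "\<dots> < \<infinity>"
    by simp
  finally show "(SUP B \<in> balls X_metric.
        (\<integral>\<^sup>+x\<in>B. maximal_function X_metric X_measure (\<lambda>y. indicator B y * f y) x \<partial>X_measure)
          / weight_mass X_measure f B) < \<infinity>" .
qed

section \<open>Failure of the reverse Hoelder inequality\<close>

lemma average_W_le: "average X_measure (seg_W j) f \<le> ennreal (3 * \<epsilon> j)"
proof (rule average_le[OF seg_W_in_balls])
  let ?\<mu> = "emeasure X_measure (seg_W j)"
  have "(\<integral>\<^sup>+y\<in>seg_W j. ennreal \<bar>f y\<bar> \<partial>X_measure)
      = (\<integral>\<^sup>+y\<in>seg_W j. ennreal (indicator (seg_W j) y * f y) \<partial>X_measure)"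
    using f_bounds(1) seg_W_subset_X[of j]
    by (intro nn_integral_cong) (auto simp: indicator_def abs_of_pos subset_iff)
  also have "\<dots> \<le> ennreal (\<epsilon> j) * (?\<mu>
      + (\<integral>\<^sup>+u\<in>{u \<in> {0<..1}. par_U j u \<in> seg_W j}. ennreal (log_kernel 3 u) \<partial>lborel))"
    by (rule nn_integral_W_le) simp
  also have "\<dots> \<le> ennreal (\<epsilon> j) * (?\<mu> + ennreal (1/2))"
  proof (intro mult_left_mono add_left_mono)
    have "(\<integral>\<^sup>+u\<in>{u \<in> {0<..1}. par_U j u \<in> seg_W j}. ennreal (log_kernel 3 u) \<partial>lborel)
        \<le> (\<integral>\<^sup>+u\<in>{0<..1}. ennreal (log_kernel (Suc 2) u) \<partial>lborel)"
      by (intro nn_integral_mono) (auto simp: indicator_def numeral_3_eq_3 numeral_2_eq_2)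
    then show "(\<integral>\<^sup>+u\<in>{u \<in> {0<..1}. par_U j u \<in> seg_W j}. ennreal (log_kernel 3 u) \<partial>lborel) \<le> ennreal (1/2)"
      using nn_integral_log_kernel_le[of 1 2] by simp
  qed simp
  \<comment> \<open>W_j has measure at least 1/4, so the kernel integral 1/2 is at most twice this
    measure; with the constant part this makes 3.\<close>
  also have "ennreal (1/2) \<le> 2 * ?\<mu>"
  proof -
    have "ennreal (1/2) = ennreal 2 * ennreal (1/4)"
      by (subst ennreal_mult[symmetric]) auto
    then show ?thesis
      using emeasure_seg_W(1)[of j] by (simp add: mult_left_mono)
  qed
  also have "?\<mu> + 2 * ?\<mu> = 3 * ?\<mu>"
    by (metis distrib_right mult_1 numeral_Bit1 numeral_Bit0 one_add_one add.commute numeral_One)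
  also have "ennreal (\<epsilon> j) * (3 * ?\<mu>) = ennreal (3 * \<epsilon> j) * ?\<mu>"
    using eps_pos[of j] by (simp add: ennreal_mult mult_ac)
  finally show "(\<integral>\<^sup>+y\<in>seg_W j. ennreal \<bar>f y\<bar> \<partial>X_measure) \<le> ennreal (3 * \<epsilon> j) * ?\<mu>"
    by (simp add: mult_left_mono add_left_mono)
qed

text \<open>Instead of a limit in j, a fixed cut-off \<delta> \<ge> \<epsilon>_j is used: on
  [\<delta>, 1] the bound \<epsilon>_j ^ p c / t survives the truncation, and its integral c ln (1 /
  \<delta>) is as large as desired. The 8 bounds the measure of W_j.\<close>

lemma average_powr_W_ge:
  assumes p: "1 < p" and \<delta>: "\<epsilon> j \<le> \<delta>" "0 < \<delta>" "\<delta> < 1"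
    and c: "0 < c" "c \<le> 1" "\<And>t. 0 < t \<Longrightarrow> t \<le> 1 \<Longrightarrow> c / t \<le> log_kernel 3 t powr p"
  shows "ennreal (\<epsilon> j powr p * (c * - ln \<delta> / 8)) \<le> average X_measure (seg_W j) (\<lambda>x. f x powr p)"
proof -
  let ?\<mu> = "emeasure X_measure (seg_W j)"
  let ?a = "\<epsilon> j powr p"
  have pw: "?a * (c / t) \<le> profile j t powr p" if t: "\<delta> \<le> t" "t \<le> 1" for t
  proof (cases "\<epsilon> j * max (log_kernel 3 t) 1 \<le> 1")
    case True
    have "?a * (c / t) \<le> ?a * log_kernel 3 t powr p"
      using c(3)[of t] t \<delta> by (intro mult_left_mono) auto
    also have "\<dots> = (\<epsilon> j * log_kernel 3 t) powr p"
      using eps_pos[of j] log_kernel_pos[of t 3] t \<delta> by (simp add: powr_mult)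
    also have "\<dots> \<le> profile j t powr p"
      using True eps_pos[of j] log_kernel_pos[of t 3] t \<delta> p unfolding profile_def
      by (intro powr_mono2) (auto intro: mult_left_mono)
    finally show ?thesis .
  next
    case False
    \<comment> \<open>Where the weight is truncated to 1, the bound holds because \<epsilon>_j ^ p
      \<le> \<epsilon>_j \<le> \<delta> and c / t \<le> 1 / \<delta>.\<close>
    have "?a * (c / t) \<le> \<epsilon> j powr 1 * (1 / \<delta>)"
      using eps_pos[of j] eps_le[of j] t \<delta> p c by (intro mult_mono powr_mono' frac_le) auto
    also have "\<dots> \<le> 1"
      using eps_pos[of j] \<delta> by simp
    finally show ?thesis
      using False by (simp add: profile_def min_def)
  qed
  have [measurable]: "(\<lambda>x. ennreal (f x powr p)) \<in> borel_measurable X_measure"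
    by measurable
  have "ennreal (?a * (c * - ln \<delta>)) = (\<integral>\<^sup>+t. ennreal (?a * (c / t)) * indicator {\<delta>..1} t \<partial>lborel)"
  proof -
    have "(\<integral>\<^sup>+t. ennreal (?a * (c / t)) * indicator {\<delta>..1} t \<partial>lborel)
        = ennreal (?a * c * ln 1 - ?a * c * ln \<delta>)"
      using \<delta> c by (intro nn_integral_FTC_Icc) (auto intro!: derivative_eq_intros)
    then show ?thesis
      by (simp add: mult.assoc)
  qed
  also have "\<dots> \<le> (\<integral>\<^sup>+t\<in>{0<..1}. ennreal (f (par_U j t) powr p) \<partial>lborel)"
    using \<delta> pw f_par_U by (intro nn_integral_mono) (auto simp: indicator_def intro!: ennreal_leI)
  also have "\<dots> = (\<integral>\<^sup>+x\<in>seg_U j. ennreal (f x powr p) \<partial>X_measure)"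
    by (rule nn_integral_seg_U[symmetric]) measurable
  also have "\<dots> \<le> (\<integral>\<^sup>+x\<in>seg_W j. ennreal \<bar>f x powr p\<bar> \<partial>X_measure)"
    by (intro nn_integral_mono) (auto simp: indicator_def seg_W_def)
  also have "\<dots> = average X_measure (seg_W j) (\<lambda>x. f x powr p) * ?\<mu>"
    using emeasure_balls_X[OF seg_W_in_balls, of j] by (simp add: average_def ennreal_divide_times)
  also have "\<dots> \<le> average X_measure (seg_W j) (\<lambda>x. f x powr p) * ennreal 8"
    by (intro mult_left_mono emeasure_seg_W) simp
  finally have "ennreal (?a * (c * - ln \<delta>)) / ennreal 8 \<le> average X_measure (seg_W j) (\<lambda>x. f x powr p)"
    by (intro divide_le_posI_ennreal) (simp_all add: mult.commute)
  moreover have "ennreal (?a * (c * - ln \<delta>)) / ennreal 8 = ennreal (?a * (c * - ln \<delta> / 8))"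
    using \<delta> c by (subst divide_ennreal) (auto simp: mult_nonneg_nonpos)
  ultimately show ?thesis
    by simp
qed

lemma not_reverse_holder_f:
  assumes lim: "\<epsilon> \<longlonglongrightarrow> 0" and p: "p > 1"
  shows "\<not> reverse_holder p X_metric X_measure f"
proof
  assume "reverse_holder p X_metric X_measure f"
  then obtain C :: real where C: "\<And>B. B \<in> balls X_metric \<Longrightarrow>
      ennreal_powr (average X_measure B (\<lambda>x. f x powr p)) (1 / p) \<le> ennreal C * average X_measure B f"
    unfolding reverse_holder_def by blast
  obtain c where c: "0 < c" "c \<le> 1" "\<And>t. 0 < t \<Longrightarrow> t \<le> 1 \<Longrightarrow> c / t \<le> log_kernel 3 t powr p"
    using log_kernel_powr_ge[OF p] by blast
  \<comment> \<open>D exceeds the factor 3 C that the inequality allows, and \<delta> is chosen so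
    that the lower bound for the average of the p-th power becomes (\<epsilon>_j D) ^ p. The maximum
    with 0 is taken because C may be negative, where \<open>ennreal C\<close> is 0.\<close>
  define D where "D = 3 * max C 0 + 1"
  define \<delta> where "\<delta> = exp (- (8 * D powr p / c))"
  have D: "D \<ge> 1"
    by (simp add: D_def)
  have \<delta>: "0 < \<delta>" "\<delta> < 1" "c * - ln \<delta> / 8 = D powr p"
    using c D by (auto simp: \<delta>_def)
  obtain j where j: "\<epsilon> j \<le> \<delta>"
    using order_tendstoD(2)[OF lim \<delta>(1)] by (auto simp: eventually_sequentially intro: less_imp_le)
  let ?avg = "average X_measure (seg_W j) (\<lambda>x. f x powr p)"
  have "ennreal (\<epsilon> j powr p * D powr p) \<le> ?avg"
    using average_powr_W_ge[OF p j \<delta>(1,2) c] unfolding \<delta>(3) .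
  then have ge: "ennreal ((\<epsilon> j * D) powr p) \<le> ?avg"
    using eps_pos[of j] D by (simp add: powr_mult)
  have le: "ennreal_powr ?avg (1 / p) \<le> ennreal (max C 0 * (3 * \<epsilon> j))"
  proof -
    have "ennreal_powr ?avg (1 / p) \<le> ennreal C * average X_measure (seg_W j) f"
      by (rule C[OF seg_W_in_balls])
    also have "\<dots> \<le> ennreal (max C 0) * ennreal (3 * \<epsilon> j)"
      by (intro mult_mono average_W_le ennreal_leI) auto
    finally show ?thesis
      using eps_pos[of j] by (simp add: ennreal_mult)
  qed
  \<comment> \<open>Needed before passing to reals, since \<open>enn2real\<close> sends infinity to
    0; it follows from the assumed inequality, whose right side is finite.\<close>
  then have fin: "?avg \<noteq> \<infinity>"
    by (auto simp: ennreal_powr_def top_unique)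
  then have "(\<epsilon> j * D) powr p \<le> enn2real ?avg"
    using enn2real_mono[OF ge] by (simp add: less_top)
  then have "((\<epsilon> j * D) powr p) powr (1 / p) \<le> enn2real ?avg powr (1 / p)"
    using p by (intro powr_mono2) auto
  then have "\<epsilon> j * D \<le> enn2real ?avg powr (1 / p)"
    using p eps_pos[of j] D by (simp add: powr_powr)
  also have "\<dots> \<le> max C 0 * (3 * \<epsilon> j)"
    using le fin eps_pos[of j] by (simp add: ennreal_powr_def ennreal_le_iff)
  finally have "\<epsilon> j \<le> 0"
    by (simp add: D_def algebra_simps)
  then show False
    using eps_pos[of j] by simp
qed

end

theorem mainTheorem3:
  fixes \<epsilon> :: "nat \<Rightarrow> real" and h :: "real \<Rightarrow> real" and f :: "real \<times> real \<Rightarrow> real"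
  assumes "\<And>j. \<epsilon> j \<in> {0<..1}"
    and "\<epsilon> \<longlonglongrightarrow> 0"
    and "\<And>t. t \<in> {0<..<1} \<Longrightarrow> h t = 1 / t * ln (exp 1 / t) powi (-3)"
    and "f = weight_f \<epsilon> h"
  shows "borel_metric_measure X_metric X_measure
    \<and> doubling X_metric X_measure
    \<and> ahlfors_regular 1 X_metric X_measure
    \<and> A_infinity X_metric X_measure f
    \<and> (\<forall>p > 1. \<not> reverse_holder p X_metric X_measure f)
    \<and> \<not> (\<forall>(m :: (real \<times> real) metric) M w.
          borel_metric_measure m M \<longrightarrow> doubling m M \<longrightarrow> A_infinity m M w
            \<longrightarrow> (\<exists>p > 1. reverse_holder p m M w))"
proof -
  interpret log_weight \<epsilon> h
  proof
    show "h t = log_kernel 3 t" if t: "t \<in> {0<..<1}" for t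
    proof -
      have "ln (exp 1 / t) = 1 - ln t"
        using t by (simp add: ln_div)
      then show ?thesis
        using assms(3)[OF t] by (simp add: log_kernel_def power_int_minus divide_inverse)
    qed
  qed (rule assms(1))
  have "A_infinity X_metric X_measure f"
    unfolding assms(4) by (rule A_infinity_f)
  moreover have "\<not> reverse_holder p X_metric X_measure f" if "p > 1" for p
    unfolding assms(4) by (rule not_reverse_holder_f[OF assms(2) that])
  ultimately show ?thesis
    using borel_metric_measure_X doubling_X ahlfors_regular_X by blast
qed

end
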